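(* Suppose $U$ and $A$ are semigroups with maps $A\times U\to U$, $(a,u)\mapsto a\cdot u$, and $A\times U\to A$, $(a,u)\mapsto a|_u$, satisfying conditions (B1)--(B8) listed in the context. Moreover, suppose $U$ is a right LCM semigroup, $A$ is left cancellative with $\mathcal{J}(A)$ totally ordered by inclusion, and for each $a\in A$ the map $u\mapsto a\cdot u$ is a bijection from $U$ to $U$. Let $\mathcal{A}$ be the universal $C^*$-algebra generated by an isometric representation $s$ of $A$ and a covariant representation $t$ of $U$ satisfying, for all $a\in A$ and $u\in U$, (K1) $s_a t_u=t_{a\cdot u}s_{a|_u}$; and (K2) $s_a^*t_u=t_z s_{a|_z}^*$, where $z\in U$ is the unique element satisfying $a\cdot z=u$. Then there exists an isomorphism $\pi:C^*(U\bowtie A)\to\mathcal{A}$ such that $\pi(v_{(u,a)})=t_us_a$ and $\pi(e_{(u,a)})=t_us_as_a^*t_u^*$ for all $(u,a)\in U\bowtie A$, where $e_{(u,a)}$ denotes $e_{(u,a)(U\bowtie A)}$, the projection associated to the principal right ideal $(u,a)(U\bowtie A)$.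
   Context: All semigroups are discrete and have an identity. A semigroup $P$ is left cancellative if $pq=pr$ implies $q=r$. For a left-cancellative $P$: $r\in P$ is a right multiple of $p$ if $r=pq$ for some $q\in P$; $r$ is a right least common multiple (right LCM) of $p,q$ if $r$ is a right common multiple of $p$ and $q$ and every right common multiple of $p$ and $q$ is a right multiple of $r$. $P$ is a right LCM semigroup if it is discrete, left cancellative, and any two elements with a right common multiple have a right LCM. For $X\subseteq P$ and $p\in P$ put $pX=\{px:x\in X\}$ and $p^{-1}X=\{y\in P:py\in X\}$. $\mathcal{J}(P)$ is the smallest family of right ideals of $P$ such that $P,\varnothing\in\mathcal{J}(P)$; $X\in\mathcal{J}(P)$ and $p\in P$ imply $pX,p^{-1}X\in\mathcal{J}(P)$; and $X,Y\in\mathcal{J}(P)$ implies $X\cap Y\in\mathcal{J}(P)$. (For a right LCM semigroup, the nonempty elements of $\mathcal{J}(P)$ are exactly the principal right ideals $pP$.) $C^*(P)$ (Li's full semigroup $C^*$-algebra) is the universal $C^*$-algebra generated by isometries $\{v_p:p\in P\}$ and projections $\{e_X:X\in\mathcal{J}(P)\}$ satisfying, for all $p,q\in P$ and $X,Y\in\mathcal{J}(P)$: (1) $v_pv_q=v_{pq}$; (2) $v_pe_Xv_p^*=e_{pX}$; (3) $e_P=1$ and $e_\varnothing=0$; (4) $e_Xe_Y=e_{X\cap Y}$. Conditions on the maps (with $e_A,e_U$ the identities, for all $a,b\in A$, $u,v\in U$): (B1) $e_A\cdot u=u$; (B2) $(ab)\cdot u=a\cdot(b\cdot u)$; (B3)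 $a\cdot e_U=e_U$; (B4) $a|_{e_U}=a$; (B5) $a\cdot(uv)=(a\cdot u)(a|_u\cdot v)$; (B6) $a|_{uv}=(a|_u)|_v$; (B7) $e_A|_u=e_A$; (B8) $(ab)|_u=a|_{b\cdot u}\,b|_u$. The (external) Zappa--Szép product $U\bowtie A$ is the set $U\times A$ with multiplication $(u,a)(v,b)=(u(a\cdot v),\,(a|_v)b)$. Under the hypotheses of the claim $U\bowtie A$ is a right LCM semigroup, and $C^*(U\bowtie A)$ is $C^*(P)$ for $P=U\bowtie A$. An isometric representation of a semigroup $P$ in a unital $C^*$-algebra is a map $p\mapsto t_p$ into isometries with $t_pt_q=t_{pq}$. A covariant representation of a right LCM semigroup $P$ is an isometric representation $t$ such that $t_p^*t_q=t_{p'}t_{q'}^*$ whenever $pP\cap qP=rP$ and $pp'=qq'=r$, and $t_p^*t_q=0$ whenever $pP\cap qP=\varnothing$ (the right-hand side does not depend on the choice of $r$). *)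

theory Defs
  imports Complex_Main "HOL-Algebra.Coset" "HOL-Algebra.Divisibility" "HOL-Algebra.Module"
begin

section \<open>Right LCM semigroups, constructible right ideals and Zappa--Szep products\<close>

text \<open>
  Semigroups with identity are the monoids of HOL-Algebra.  There, \<open>p divides r\<close> means that \<open>r\<close> is
  a right multiple of \<open>p\<close>, \<open>r lcmof p q\<close> that \<open>r\<close> is a right LCM of \<open>p\<close> and \<open>q\<close> (given that
  \<open>r\<close> is in the carrier), and \<open>p <# X\<close> is the set \<open>pX\<close>.
\<close>

definition left_cancellative :: "('p, 'm) monoid_scheme \<Rightarrow> bool" where
  "left_cancellative P \<longleftrightarrow>
     (\<forall>p\<in>carrier P. \<forall>q\<in>carrier P. \<forall>r\<in>carrier P. p \<otimes>\<^bsub>P\<^esub> q = p \<otimes>\<^bsub>P\<^esub> r \<longrightarrow> q = r)"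

definition right_LCM_semigroup :: "('p, 'm) monoid_scheme \<Rightarrow> bool" where
  "right_LCM_semigroup P \<longleftrightarrow> monoid P \<and> left_cancellative P \<and>
     (\<forall>p\<in>carrier P. \<forall>q\<in>carrier P.
        (\<exists>r\<in>carrier P. p divides\<^bsub>P\<^esub> r \<and> q divides\<^bsub>P\<^esub> r) \<longrightarrow>
        (\<exists>r\<in>carrier P. r lcmof\<^bsub>P\<^esub> p q))"

text \<open>\<open>\<J>(P)\<close>; all its members are right ideals because the rules below preserve right ideals.\<close>

inductive_set constructible_ideals :: "('p, 'm) monoid_scheme \<Rightarrow> 'p set set"
  for P :: "('p, 'm) monoid_scheme" where
  whole: "carrier P \<in> constructible_ideals P"
| empty: "{} \<in> constructible_ideals P"
| translate: "X \<in> constructible_ideals P \<Longrightarrow> p \<in> carrier P \<Longrightarrow> p <#\<^bsub>P\<^esub> X \<in> constructible_ideals P"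
| preimage: "X \<in> constructible_ideals P \<Longrightarrow> p \<in> carrier P \<Longrightarrow>
    {y \<in> carrier P. p \<otimes>\<^bsub>P\<^esub> y \<in> X} \<in> constructible_ideals P"
| inter: "X \<in> constructible_ideals P \<Longrightarrow> Y \<in> constructible_ideals P \<Longrightarrow>
    X \<inter> Y \<in> constructible_ideals P"

text \<open>\<open>act a u\<close> is \<open>a \<cdot> u\<close> and \<open>res a u\<close> is the restriction of \<open>a\<close> to \<open>u\<close>.\<close>

locale zappa_szep_maps = U: monoid U + A: monoid A
  for U :: "('u, 'm) monoid_scheme" and A :: "('a, 'n) monoid_scheme" +
  fixes act :: "'a \<Rightarrow> 'u \<Rightarrow> 'u" and res :: "'a \<Rightarrow> 'u \<Rightarrow> 'a"
  assumes act_closed: "a \<in> carrier A \<Longrightarrow> u \<in> carrier U \<Longrightarrow> act a u \<in> carrier U"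
    and res_closed: "a \<in> carrier A \<Longrightarrow> u \<in> carrier U \<Longrightarrow> res a u \<in> carrier A"
    and B1: "u \<in> carrier U \<Longrightarrow> act \<one>\<^bsub>A\<^esub> u = u"
    and B2: "a \<in> carrier A \<Longrightarrow> b \<in> carrier A \<Longrightarrow> u \<in> carrier U \<Longrightarrow>
      act (a \<otimes>\<^bsub>A\<^esub> b) u = act a (act b u)"
    and B3: "a \<in> carrier A \<Longrightarrow> act a \<one>\<^bsub>U\<^esub> = \<one>\<^bsub>U\<^esub>"
    and B4: "a \<in> carrier A \<Longrightarrow> res a \<one>\<^bsub>U\<^esub> = a"
    and B5: "a \<in> carrier A \<Longrightarrow> u \<in> carrier U \<Longrightarrow> v \<in> carrier U \<Longrightarrow>
      act a (u \<otimes>\<^bsub>U\<^esub> v) = act a u \<otimes>\<^bsub>U\<^esub> act (res a u) v"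
    and B6: "a \<in> carrier A \<Longrightarrow> u \<in> carrier U \<Longrightarrow> v \<in> carrier U \<Longrightarrow>
      res a (u \<otimes>\<^bsub>U\<^esub> v) = res (res a u) v"
    and B7: "u \<in> carrier U \<Longrightarrow> res \<one>\<^bsub>A\<^esub> u = \<one>\<^bsub>A\<^esub>"
    and B8: "a \<in> carrier A \<Longrightarrow> b \<in> carrier A \<Longrightarrow> u \<in> carrier U \<Longrightarrow>
      res (a \<otimes>\<^bsub>A\<^esub> b) u = res a (act b u) \<otimes>\<^bsub>A\<^esub> res b u"

definition zappa_szep ::
    "('u, 'm) monoid_scheme \<Rightarrow> ('a, 'n) monoid_scheme \<Rightarrow> ('a \<Rightarrow> 'u \<Rightarrow> 'u) \<Rightarrow> ('a \<Rightarrow> 'u \<Rightarrow> 'a) \<Rightarrow>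
     ('u \<times> 'a) monoid" where
  "zappa_szep U A act res =
     \<lparr>carrier = carrier U \<times> carrier A,
      mult = (\<lambda>(u, a) (v, b). (u \<otimes>\<^bsub>U\<^esub> act a v, res a v \<otimes>\<^bsub>A\<^esub> b)),
      one = (\<one>\<^bsub>U\<^esub>, \<one>\<^bsub>A\<^esub>)\<rparr>"

section \<open>Unital C*-algebras\<close>

definition complex_field :: "complex ring" where
  "complex_field = \<lparr>carrier = UNIV, mult = (*), one = 1, zero = 0, add = (+)\<rparr>"

record 'c cstar_algebra = "(complex, 'c) module" +
  adj :: "'c \<Rightarrow> 'c"
  nrm :: "'c \<Rightarrow> real"

locale cstar_algebra = module complex_field C + ring C
  for C :: "'c cstar_algebra" (structure) +
  assumes smult_mult_left: "x \<in> carrier C \<Longrightarrow> y \<in> carrier C \<Longrightarrow> (c \<odot> x) \<otimes> y = c \<odot> (x \<otimes> y)"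
    and smult_mult_right: "x \<in> carrier C \<Longrightarrow> y \<in> carrier C \<Longrightarrow> x \<otimes> (c \<odot> y) = c \<odot> (x \<otimes> y)"
    and adj_closed: "x \<in> carrier C \<Longrightarrow> adj C x \<in> carrier C"
    and adj_adj: "x \<in> carrier C \<Longrightarrow> adj C (adj C x) = x"
    and adj_add: "x \<in> carrier C \<Longrightarrow> y \<in> carrier C \<Longrightarrow> adj C (x \<oplus> y) = adj C x \<oplus> adj C y"
    and adj_smult: "x \<in> carrier C \<Longrightarrow> adj C (c \<odot> x) = cnj c \<odot> adj C x"
    and adj_mult: "x \<in> carrier C \<Longrightarrow> y \<in> carrier C \<Longrightarrow> adj C (x \<otimes> y) = adj C y \<otimes> adj C x"
    and nrm_nonneg: "x \<in> carrier C \<Longrightarrow> 0 \<le> nrm C x"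
    and nrm_eq_0: "x \<in> carrier C \<Longrightarrow> nrm C x = 0 \<longleftrightarrow> x = \<zero>"
    and nrm_add: "x \<in> carrier C \<Longrightarrow> y \<in> carrier C \<Longrightarrow> nrm C (x \<oplus> y) \<le> nrm C x + nrm C y"
    and nrm_smult: "x \<in> carrier C \<Longrightarrow> nrm C (c \<odot> x) = cmod c * nrm C x"
    and nrm_mult: "x \<in> carrier C \<Longrightarrow> y \<in> carrier C \<Longrightarrow> nrm C (x \<otimes> y) \<le> nrm C x * nrm C y"
    and cstar_identity: "x \<in> carrier C \<Longrightarrow> nrm C (adj C x \<otimes> x) = (nrm C x)\<^sup>2"
    and complete: "range \<sigma> \<subseteq> carrier C \<Longrightarrow>
      (\<forall>\<epsilon>>0. \<exists>N. \<forall>m\<ge>N. \<forall>n\<ge>N. nrm C (\<sigma> m \<ominus> \<sigma> n) < \<epsilon>) \<Longrightarrow>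
      \<exists>x\<in>carrier C. (\<lambda>n. nrm C (\<sigma> n \<ominus> x)) \<longlonglongrightarrow> 0"

definition cstar_hom :: "'c cstar_algebra \<Rightarrow> 'd cstar_algebra \<Rightarrow> ('c \<Rightarrow> 'd) set" where
  "cstar_hom C D = {\<phi> \<in> ring_hom C D.
     (\<forall>x\<in>carrier C. \<forall>c. \<phi> (c \<odot>\<^bsub>C\<^esub> x) = c \<odot>\<^bsub>D\<^esub> \<phi> x) \<and>
     (\<forall>x\<in>carrier C. \<phi> (adj C x) = adj D (\<phi> x))}"

definition cstar_iso :: "'c cstar_algebra \<Rightarrow> 'd cstar_algebra \<Rightarrow> ('c \<Rightarrow> 'd) set" where
  "cstar_iso C D = {\<phi> \<in> cstar_hom C D. bij_betw \<phi> (carrier C) (carrier D)}"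

definition cstar_subalgebra :: "'c set \<Rightarrow> 'c cstar_algebra \<Rightarrow> bool" where
  "cstar_subalgebra S C \<longleftrightarrow> S \<subseteq> carrier C \<and> \<one>\<^bsub>C\<^esub> \<in> S \<and>
     (\<forall>x\<in>S. \<forall>y\<in>S. x \<oplus>\<^bsub>C\<^esub> y \<in> S \<and> x \<otimes>\<^bsub>C\<^esub> y \<in> S) \<and>
     (\<forall>x\<in>S. adj C x \<in> S \<and> (\<forall>c. c \<odot>\<^bsub>C\<^esub> x \<in> S)) \<and>
     (\<forall>\<sigma>. \<forall>x\<in>carrier C. range \<sigma> \<subseteq> S \<and> (\<lambda>n. nrm C (\<sigma> n \<ominus>\<^bsub>C\<^esub> x)) \<longlonglongrightarrow> 0 \<longrightarrow> x \<in> S)"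

definition isometry_in :: "'c cstar_algebra \<Rightarrow> 'c \<Rightarrow> bool" where
  "isometry_in C x \<longleftrightarrow> x \<in> carrier C \<and> adj C x \<otimes>\<^bsub>C\<^esub> x = \<one>\<^bsub>C\<^esub>"

definition projection_in :: "'c cstar_algebra \<Rightarrow> 'c \<Rightarrow> bool" where
  "projection_in C x \<longleftrightarrow> x \<in> carrier C \<and> adj C x = x \<and> x \<otimes>\<^bsub>C\<^esub> x = x"

text \<open>
  \<open>universal_cstar I rel C g\<close>: \<open>C\<close> is the universal unital C*-algebra generated by elements
  \<open>g i\<close> (\<open>i \<in> I\<close>) subject to the relations \<open>rel\<close>.  As HOL cannot quantify over types inside a formula,
  the universal property ranges over the C*-algebras whose carrier is a set in the type \<open>'c\<close>.
\<close>

definition universal_cstar ::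
    "'i set \<Rightarrow> ('c cstar_algebra \<Rightarrow> ('i \<Rightarrow> 'c) \<Rightarrow> bool) \<Rightarrow> 'c cstar_algebra \<Rightarrow> ('i \<Rightarrow> 'c) \<Rightarrow> bool" where
  "universal_cstar I rel C g \<longleftrightarrow>
     cstar_algebra C \<and> g ` I \<subseteq> carrier C \<and> rel C g \<and>
     (\<forall>S. cstar_subalgebra S C \<and> g ` I \<subseteq> S \<longrightarrow> S = carrier C) \<and>
     (\<forall>D h. cstar_algebra D \<and> h ` I \<subseteq> carrier D \<and> rel D h \<longrightarrow>
        (\<exists>\<phi>\<in>cstar_hom C D. (\<forall>i\<in>I. \<phi> (g i) = h i) \<and>
           (\<forall>\<psi>\<in>cstar_hom C D. (\<forall>i\<in>I. \<psi> (g i) = h i) \<longrightarrow> (\<forall>x\<in>carrier C. \<psi> x = \<phi> x))))"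

section \<open>Semigroup C*-algebras\<close>

definition li_relations ::
    "('p, 'm) monoid_scheme \<Rightarrow> 'c cstar_algebra \<Rightarrow> ('p \<Rightarrow> 'c) \<Rightarrow> ('p set \<Rightarrow> 'c) \<Rightarrow> bool" where
  "li_relations P C v e \<longleftrightarrow>
     (\<forall>p\<in>carrier P. isometry_in C (v p)) \<and>
     (\<forall>X\<in>constructible_ideals P. projection_in C (e X)) \<and>
     (\<forall>p\<in>carrier P. \<forall>q\<in>carrier P. v p \<otimes>\<^bsub>C\<^esub> v q = v (p \<otimes>\<^bsub>P\<^esub> q)) \<and>
     (\<forall>p\<in>carrier P. \<forall>X\<in>constructible_ideals P.
        v p \<otimes>\<^bsub>C\<^esub> e X \<otimes>\<^bsub>C\<^esub> adj C (v p) = e (p <#\<^bsub>P\<^esub> X)) \<and>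
     e (carrier P) = \<one>\<^bsub>C\<^esub> \<and> e {} = \<zero>\<^bsub>C\<^esub> \<and>
     (\<forall>X\<in>constructible_ideals P. \<forall>Y\<in>constructible_ideals P. e X \<otimes>\<^bsub>C\<^esub> e Y = e (X \<inter> Y))"

text \<open>\<open>C\<close>, with generators \<open>v\<close> and \<open>e\<close>, is Li's full semigroup C*-algebra \<open>C*(P)\<close>.\<close>

definition full_semigroup_cstar ::
    "('p, 'm) monoid_scheme \<Rightarrow> 'c cstar_algebra \<Rightarrow> ('p \<Rightarrow> 'c) \<Rightarrow> ('p set \<Rightarrow> 'c) \<Rightarrow> bool" where
  "full_semigroup_cstar P C v e \<longleftrightarrow>
     universal_cstar (carrier P <+> constructible_ideals P)
       (\<lambda>D h. li_relations P D (h \<circ> Inl) (h \<circ> Inr)) C (case_sum v e)"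

definition isometric_rep :: "('p, 'm) monoid_scheme \<Rightarrow> 'c cstar_algebra \<Rightarrow> ('p \<Rightarrow> 'c) \<Rightarrow> bool" where
  "isometric_rep P C t \<longleftrightarrow>
     (\<forall>p\<in>carrier P. isometry_in C (t p)) \<and>
     (\<forall>p\<in>carrier P. \<forall>q\<in>carrier P. t p \<otimes>\<^bsub>C\<^esub> t q = t (p \<otimes>\<^bsub>P\<^esub> q))"

definition covariant_rep :: "('p, 'm) monoid_scheme \<Rightarrow> 'c cstar_algebra \<Rightarrow> ('p \<Rightarrow> 'c) \<Rightarrow> bool" where
  "covariant_rep P C t \<longleftrightarrow> isometric_rep P C t \<and>
     (\<forall>p\<in>carrier P. \<forall>q\<in>carrier P. \<forall>r\<in>carrier P. \<forall>p'\<in>carrier P. \<forall>q'\<in>carrier P.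
        (p <#\<^bsub>P\<^esub> carrier P) \<inter> (q <#\<^bsub>P\<^esub> carrier P) = r <#\<^bsub>P\<^esub> carrier P \<and>
        p \<otimes>\<^bsub>P\<^esub> p' = r \<and> q \<otimes>\<^bsub>P\<^esub> q' = r \<longrightarrow>
        adj C (t p) \<otimes>\<^bsub>C\<^esub> t q = t p' \<otimes>\<^bsub>C\<^esub> adj C (t q')) \<and>
     (\<forall>p\<in>carrier P. \<forall>q\<in>carrier P.
        (p <#\<^bsub>P\<^esub> carrier P) \<inter> (q <#\<^bsub>P\<^esub> carrier P) = {} \<longrightarrow>
        adj C (t p) \<otimes>\<^bsub>C\<^esub> t q = \<zero>\<^bsub>C\<^esub>)"

text \<open>In (K2), \<open>z\<close> is the unique element with \<open>act a z = u\<close>, as \<open>act a\<close> is a bijection of \<open>U\<close>.\<close>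

definition zs_relations ::
    "('u, 'm) monoid_scheme \<Rightarrow> ('a, 'n) monoid_scheme \<Rightarrow> ('a \<Rightarrow> 'u \<Rightarrow> 'u) \<Rightarrow> ('a \<Rightarrow> 'u \<Rightarrow> 'a) \<Rightarrow>
     'c cstar_algebra \<Rightarrow> ('a \<Rightarrow> 'c) \<Rightarrow> ('u \<Rightarrow> 'c) \<Rightarrow> bool" where
  "zs_relations U A act res C s t \<longleftrightarrow>
     isometric_rep A C s \<and> covariant_rep U C t \<and>
     (\<forall>a\<in>carrier A. \<forall>u\<in>carrier U. s a \<otimes>\<^bsub>C\<^esub> t u = t (act a u) \<otimes>\<^bsub>C\<^esub> s (res a u)) \<and>
     (\<forall>a\<in>carrier A. \<forall>u\<in>carrier U. \<forall>z\<in>carrier U. act a z = u \<longrightarrow>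
        adj C (s a) \<otimes>\<^bsub>C\<^esub> t u = t z \<otimes>\<^bsub>C\<^esub> adj C (s (res a z)))"

definition zs_universal_cstar ::
    "('u, 'm) monoid_scheme \<Rightarrow> ('a, 'n) monoid_scheme \<Rightarrow> ('a \<Rightarrow> 'u \<Rightarrow> 'u) \<Rightarrow> ('a \<Rightarrow> 'u \<Rightarrow> 'a) \<Rightarrow>
     'c cstar_algebra \<Rightarrow> ('a \<Rightarrow> 'c) \<Rightarrow> ('u \<Rightarrow> 'c) \<Rightarrow> bool" where
  "zs_universal_cstar U A act res C s t \<longleftrightarrow>
     universal_cstar (carrier A <+> carrier U)
       (\<lambda>D h. zs_relations U A act res D (h \<circ> Inl) (h \<circ> Inr)) C (case_sum s t)"

end

theory Submission
  imports Defs
begin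

text \<open>
  Both algebras are universal, and the proof shows that they classify the same representations.
  Write \<open>P = U \<bowtie> A\<close>.  Since \<open>P\<close> is a right LCM semigroup, its nonempty constructible ideals are
  principal, and the relations \<open>v\<^sub>pe\<^sub>Pv\<^sub>p\<^sup>* = e\<^bsub>pP\<^esub>\<close> and \<open>e\<^sub>P = 1\<close> force \<open>e\<^bsub>pP\<^esub> = v\<^sub>pv\<^sub>p\<^sup>*\<close>.  The relation
  \<open>e\<^sub>Xe\<^sub>Y = e\<^bsub>X\<inter>Y\<^esub>\<close> is then covariance of \<open>v\<close>, read off on range projections
  (\<open>covariant_rep_iff_range_projection\<close>), so that Li's relations for \<open>P\<close> amount to a covariant
  representation of \<open>P\<close> (\<open>li_relations_covariant_rep\<close>, \<open>covariant_rep_li_relations\<close>).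

  The covariant representations \<open>V\<close> of \<open>P\<close> correspond to the pairs \<open>(s, t)\<close> satisfying (K1) and (K2)
  by \<open>V\<^bsub>(u,a)\<^esub> = t\<^sub>us\<^sub>a\<close>, \<open>s\<^sub>a = V\<^bsub>(1,a)\<^esub>\<close> and \<open>t\<^sub>u = V\<^bsub>(u,1)\<^esub>\<close>.  What makes this work is the description
  of \<open>(u, a)P \<inter> (v, b)P\<close>: it is empty if \<open>uU \<inter> vU\<close> is, and if \<open>uU \<inter> vU = wU\<close> with
  \<open>w = u(a\<cdot>z) = v(b\<cdot>y)\<close>, then it is generated by \<open>(w, b|\<^sub>y)\<close> or by \<open>(w, a|\<^sub>z)\<close>, according to which
  of \<open>a|\<^sub>z\<close> and \<open>b|\<^sub>y\<close> is a right multiple of the other (\<open>ZS_common_multiple\<close>).  Bijectivity of the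
  action provides \<open>z\<close> and \<open>y\<close>, and the chain condition on the ideals of \<open>A\<close> makes the two
  restrictions comparable.  The same elements \<open>z\<close> and \<open>y\<close> appear when
  \<open>(t\<^sub>us\<^sub>a)\<^sup>*(t\<^sub>vs\<^sub>b)\<close> is rewritten by covariance of \<open>t\<close> and (K2), which gives covariance of \<open>V\<close>
  (\<open>zs_relations_covariant_rep\<close>); conversely (K1), (K2) and covariance of \<open>t\<close> are instances of
  covariance of \<open>V\<close> (\<open>covariant_rep_zs_relations\<close>).

  The two universal properties now give homomorphisms in both directions which invert each other
  on generators, and uniqueness makes them mutually inverse.
\<close>

section \<open>Principal right ideals\<close>

context monoid
begin

lemma principal_mem_iff: "x \<in> p <# carrier G \<longleftrightarrow> p divides x"
  by (auto simp: l_coset_def factor_def)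

lemma principalE:
  assumes "x \<in> p <# carrier G"
  obtains c where "c \<in> carrier G" "p \<otimes> c = x"
  using assms by (auto simp: l_coset_def)

lemma principal_subset_carrier: "p \<in> carrier G \<Longrightarrow> p <# carrier G \<subseteq> carrier G"
  by (auto simp: l_coset_def)

lemma generator_mem_principal: "p \<in> carrier G \<Longrightarrow> p \<in> p <# carrier G"
  by (auto simp: principal_mem_iff)

lemma principal_mult_subset:
  "p \<in> carrier G \<Longrightarrow> x \<in> carrier G \<Longrightarrow> (p \<otimes> x) <# carrier G \<subseteq> p <# carrier G"
  unfolding principal_mem_iff subset_iff by (meson dividesI' divides_trans divides_refl)

lemma principal_translate:
  "p \<in> carrier G \<Longrightarrow> q \<in> carrier G \<Longrightarrow> p <# (q <# carrier G) = (p \<otimes> q) <# carrier G"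
  by (auto simp: l_coset_def m_assoc)

lemma principal_one: "\<one> <# carrier G = carrier G"
  by (auto simp: l_coset_def)

lemma principal_constructible: "p \<in> carrier G \<Longrightarrow> p <# carrier G \<in> constructible_ideals G"
  by (intro constructible_ideals.translate constructible_ideals.whole)

lemma lcm_iff_principal_Int:
  assumes "p \<in> carrier G" "q \<in> carrier G" "r \<in> carrier G"
  shows "r lcmof p q \<longleftrightarrow> (p <# carrier G) \<inter> (q <# carrier G) = r <# carrier G"
proof
  assume r: "r lcmof p q"
  have "y \<in> p <# carrier G \<and> y \<in> q <# carrier G \<longleftrightarrow> y \<in> r <# carrier G" for y
  proof
    assume y: "y \<in> p <# carrier G \<and> y \<in> q <# carrier G"
    then have "y \<in> carrier G" using principal_subset_carrier[OF assms(1)] by blast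
    with r y show "y \<in> r <# carrier G"
      unfolding islcm_def principal_mem_iff by simp
  next
    assume "y \<in> r <# carrier G"
    with r assms show "y \<in> p <# carrier G \<and> y \<in> q <# carrier G"
      unfolding islcm_def principal_mem_iff by (meson divides_trans)
  qed
  then show "(p <# carrier G) \<inter> (q <# carrier G) = r <# carrier G" by blast
next
  assume eq: "(p <# carrier G) \<inter> (q <# carrier G) = r <# carrier G"
  then have "y \<in> r <# carrier G \<longleftrightarrow> p divides y \<and> q divides y" for y
    by (auto simp flip: principal_mem_iff)
  then show "r lcmof p q"
    using generator_mem_principal[OF assms(3)] by (auto simp: islcm_def principal_mem_iff)
qed

end

lemma right_LCM_semigroup_iff:
  "right_LCM_semigroup P \<longleftrightarrow> monoid P \<and> left_cancellative P \<and>
     (\<forall>p\<in>carrier P. \<forall>q\<in>carrier P.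
        (p <#\<^bsub>P\<^esub> carrier P) \<inter> (q <#\<^bsub>P\<^esub> carrier P) = {} \<or>
        (\<exists>r\<in>carrier P. (p <#\<^bsub>P\<^esub> carrier P) \<inter> (q <#\<^bsub>P\<^esub> carrier P) = r <#\<^bsub>P\<^esub> carrier P))"
proof (cases "monoid P")
  case True
  interpret monoid P by fact
  have "(\<exists>r\<in>carrier P. p divides\<^bsub>P\<^esub> r \<and> q divides\<^bsub>P\<^esub> r) \<longleftrightarrow>
      (p <#\<^bsub>P\<^esub> carrier P) \<inter> (q <#\<^bsub>P\<^esub> carrier P) \<noteq> {}" if "p \<in> carrier P" for p q
    using principal_subset_carrier[OF that] by (auto simp flip: principal_mem_iff)
  then show ?thesis
    unfolding right_LCM_semigroup_def by (simp add: lcm_iff_principal_Int True) blast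
qed (auto simp: right_LCM_semigroup_def)

text \<open>
  Cancelling \<open>p\<close> turns \<open>pP \<inter> qP = pp'P\<close> into \<open>p\<^sup>-\<^sup>1(qP) = p'P\<close>, so the preimage rule does not
  leave the principal ideals.
\<close>

lemma right_LCM_constructible_principal:
  assumes "right_LCM_semigroup P" and "X \<in> constructible_ideals P"
  shows "X = {} \<or> (\<exists>p\<in>carrier P. X = p <#\<^bsub>P\<^esub> carrier P)"
proof -
  interpret monoid P using assms(1) by (simp add: right_LCM_semigroup_def)
  have cancel: "x = y" if "p \<otimes>\<^bsub>P\<^esub> x = p \<otimes>\<^bsub>P\<^esub> y" "p \<in> carrier P" "x \<in> carrier P" "y \<in> carrier P"
    for p x y
    using assms(1) that unfolding right_LCM_semigroup_def left_cancellative_def by blast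
  have meet: "(p <#\<^bsub>P\<^esub> carrier P) \<inter> (q <#\<^bsub>P\<^esub> carrier P) = {} \<or>
        (\<exists>r\<in>carrier P. (p <#\<^bsub>P\<^esub> carrier P) \<inter> (q <#\<^bsub>P\<^esub> carrier P) = r <#\<^bsub>P\<^esub> carrier P)"
    if "p \<in> carrier P" "q \<in> carrier P" for p q
    using assms(1) that by (simp add: right_LCM_semigroup_iff)
  show ?thesis
    using assms(2)
  proof (induction rule: constructible_ideals.induct)
    case whole
    then show ?case using principal_one by (intro disjI2 bexI[of _ "\<one>\<^bsub>P\<^esub>"]) auto
  next
    case empty
    then show ?case by simp
  next
    case (translate X p)
    then show ?case
      by (auto simp: principal_translate) (auto simp: l_coset_def)
  next
    case (preimage X p)
    show ?case
    proof (cases "X = {}")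
      case False
      with preimage obtain q where q: "q \<in> carrier P" "X = q <#\<^bsub>P\<^esub> carrier P" by auto
      let ?Y = "{y \<in> carrier P. p \<otimes>\<^bsub>P\<^esub> y \<in> X}"
      have Y: "y \<in> ?Y \<longleftrightarrow> y \<in> carrier P \<and> p \<otimes>\<^bsub>P\<^esub> y \<in> (p <#\<^bsub>P\<^esub> carrier P) \<inter> (q <#\<^bsub>P\<^esub> carrier P)" for y
        using q(2) by (auto simp: l_coset_def)
      from meet[OF preimage(2) q(1)] show ?thesis
      proof
        assume "(p <#\<^bsub>P\<^esub> carrier P) \<inter> (q <#\<^bsub>P\<^esub> carrier P) = {}"
        with Y show ?thesis by blast
      next
        assume "\<exists>r\<in>carrier P. (p <#\<^bsub>P\<^esub> carrier P) \<inter> (q <#\<^bsub>P\<^esub> carrier P) = r <#\<^bsub>P\<^esub> carrier P"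
        then obtain r where r: "r \<in> carrier P"
          "(p <#\<^bsub>P\<^esub> carrier P) \<inter> (q <#\<^bsub>P\<^esub> carrier P) = r <#\<^bsub>P\<^esub> carrier P" by blast
        then have "r \<in> p <#\<^bsub>P\<^esub> carrier P" using generator_mem_principal by blast
        then obtain p' where p': "p' \<in> carrier P" "r = p \<otimes>\<^bsub>P\<^esub> p'" by (auto simp: l_coset_def)
        have "y \<in> ?Y \<longleftrightarrow> y \<in> p' <#\<^bsub>P\<^esub> carrier P" for y
          unfolding Y r(2) p'(2) using preimage(2) p'(1) m_assoc
          by (auto simp: l_coset_def) (metis cancel m_closed)
        then show ?thesis using p'(1) by blast
      qed
    qed simp
  next
    case (inter X Y)
    then show ?case using meet by (metis Int_empty_left Int_empty_right)
  qed
qed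

section \<open>Covariant representations and range projections\<close>

context cstar_algebra
begin

lemma adj_one: "adj C \<one> = \<one>"
  by (metis adj_adj adj_closed adj_mult local.one_closed local.r_one local.l_one)

lemma adj_zero: "adj C \<zero> = \<zero>"
  by (metis adj_add adj_closed  local.add.l_cancel_one' local.zero_closed local.l_zero)

lemma isometric_repD:
  assumes "isometric_rep P C t" "p \<in> carrier P"
  shows "t p \<in> carrier C" "adj C (t p) \<in> carrier C" "adj C (t p) \<otimes> t p = \<one>"
  using assms by (auto simp: isometric_rep_def isometry_in_def adj_closed)

lemma isometric_rep_mult:
  "isometric_rep P C t \<Longrightarrow> p \<in> carrier P \<Longrightarrow> q \<in> carrier P \<Longrightarrow> t p \<otimes> t q = t (p \<otimes>\<^bsub>P\<^esub> q)"
  by (simp add: isometric_rep_def)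

lemma isometric_rep_cancel:
  "isometric_rep P C t \<Longrightarrow> p \<in> carrier P \<Longrightarrow> x \<in> carrier C \<Longrightarrow> adj C (t p) \<otimes> (t p \<otimes> x) = x"
  using isometric_repD m_assoc l_one by metis

lemma isometric_rep_one:
  assumes "monoid P" "isometric_rep P C t"
  shows "t \<one>\<^bsub>P\<^esub> = \<one>"
proof -
  interpret P: monoid P by fact
  have "t \<one>\<^bsub>P\<^esub> = adj C (t \<one>\<^bsub>P\<^esub>) \<otimes> (t \<one>\<^bsub>P\<^esub> \<otimes> t \<one>\<^bsub>P\<^esub>)"
    using isometric_repD(1)[OF assms(2)] isometric_rep_cancel[OF assms(2)] by simp
  also have "\<dots> = \<one>"
    using isometric_repD(3)[OF assms(2)] isometric_rep_mult[OF assms(2)] by simp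
  finally show ?thesis .
qed

definition range_projection :: "('p \<Rightarrow> 'c) \<Rightarrow> 'p \<Rightarrow> 'c" where
  "range_projection t p = t p \<otimes> adj C (t p)"

lemma projection_range_projection:
  assumes "isometric_rep P C t" "p \<in> carrier P"
  shows "projection_in C (range_projection t p)"
  using isometric_repD[OF assms] isometric_rep_cancel[OF assms]
  by (simp add: projection_in_def range_projection_def adj_mult adj_adj m_assoc)

lemma range_projection_absorb:
  assumes "monoid P" "isometric_rep P C t" "p \<in> carrier P" "x \<in> carrier P"
  shows "range_projection t p \<otimes> range_projection t (p \<otimes>\<^bsub>P\<^esub> x) = range_projection t (p \<otimes>\<^bsub>P\<^esub> x)"
proof -
  interpret P: monoid P by fact
  have px: "t (p \<otimes>\<^bsub>P\<^esub> x) = t p \<otimes> t x" using isometric_rep_mult[OF assms(2-4)] by simp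
  show ?thesis
    using isometric_repD[OF assms(2,3)] isometric_repD[OF assms(2,4)] isometric_rep_cancel[OF assms(2,3)]
    by (simp add: range_projection_def px adj_mult m_assoc)
qed

text \<open>
  Generators of the same ideal are right multiples of each other, so their range projections
  dominate each other.
\<close>

lemma range_projection_cong:
  assumes "monoid P" "isometric_rep P C t" "p \<in> carrier P" "q \<in> carrier P"
    and "p <#\<^bsub>P\<^esub> carrier P = q <#\<^bsub>P\<^esub> carrier P"
  shows "range_projection t p = range_projection t q"
proof -
  interpret P: monoid P by fact
  have "p \<in> q <#\<^bsub>P\<^esub> carrier P" "q \<in> p <#\<^bsub>P\<^esub> carrier P"
    using P.generator_mem_principal[OF assms(3)] P.generator_mem_principal[OF assms(4)]
    unfolding assms(5) by auto
  then obtain x y where x: "x \<in> carrier P" "q \<otimes>\<^bsub>P\<^esub> x = p" and y: "y \<in> carrier P" "p \<otimes>\<^bsub>P\<^esub> y = q"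
    by (elim P.principalE) blast
  note proj = projection_range_projection[OF assms(2), unfolded projection_in_def]
  have "range_projection t q \<otimes> range_projection t p = range_projection t p"
    using range_projection_absorb[OF assms(1,2,4) x(1)] unfolding x(2) .
  moreover have "range_projection t p \<otimes> range_projection t q = range_projection t q"
    using range_projection_absorb[OF assms(1,2,3) y(1)] unfolding y(2) .
  ultimately show ?thesis
    using adj_mult[of "range_projection t p" "range_projection t q"] proj assms(3,4) by metis
qed

text \<open>
  The two sides are related by compression: \<open>t\<^sub>p\<^sup>*t\<^sub>q = t\<^sub>p\<^sup>*(t\<^sub>pt\<^sub>p\<^sup>*t\<^sub>qt\<^sub>q\<^sup>*)t\<^sub>q\<close>.
  Range projections depend on the ideals \<open>pP\<close> alone, and on them covariance becomes Li's relation
  \<open>e\<^sub>Xe\<^sub>Y = e\<^bsub>X\<inter>Y\<^esub>\<close>.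
\<close>

lemma covariant_rep_iff_range_projection:
  assumes "monoid P" "isometric_rep P C t"
  shows "covariant_rep P C t \<longleftrightarrow>
    (\<forall>p\<in>carrier P. \<forall>q\<in>carrier P.
      ((p <#\<^bsub>P\<^esub> carrier P) \<inter> (q <#\<^bsub>P\<^esub> carrier P) = {} \<longrightarrow>
        range_projection t p \<otimes> range_projection t q = \<zero>) \<and>
      (\<forall>r\<in>carrier P. (p <#\<^bsub>P\<^esub> carrier P) \<inter> (q <#\<^bsub>P\<^esub> carrier P) = r <#\<^bsub>P\<^esub> carrier P \<longrightarrow>
        range_projection t p \<otimes> range_projection t q = range_projection t r))"
    (is "?cov \<longleftrightarrow> ?proj")
proof -
  interpret P: monoid P by fact
  note iso [simp] = isometric_repD[OF assms(2)] isometric_rep_cancel[OF assms(2)]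
  have expand: "range_projection t p \<otimes> range_projection t q =
      t p \<otimes> (adj C (t p) \<otimes> t q) \<otimes> adj C (t q)"
    and collapse: "adj C (t p) \<otimes> t q =
      adj C (t p) \<otimes> (range_projection t p \<otimes> range_projection t q) \<otimes> t q"
    if "p \<in> carrier P" "q \<in> carrier P" for p q
    using that by (simp_all add: range_projection_def m_assoc)
  show ?thesis
  proof
    assume cov: ?cov
    show ?proj
    proof (intro ballI conjI impI)
      fix p q assume pq: "p \<in> carrier P" "q \<in> carrier P"
        and "(p <#\<^bsub>P\<^esub> carrier P) \<inter> (q <#\<^bsub>P\<^esub> carrier P) = {}"
      then have "adj C (t p) \<otimes> t q = \<zero>" using cov unfolding covariant_rep_def by blast
      then show "range_projection t p \<otimes> range_projection t q = \<zero>" using pq by (simp add: expand)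
    next
      fix p q r assume pq: "p \<in> carrier P" "q \<in> carrier P" and r: "r \<in> carrier P"
        and meet: "(p <#\<^bsub>P\<^esub> carrier P) \<inter> (q <#\<^bsub>P\<^esub> carrier P) = r <#\<^bsub>P\<^esub> carrier P"
      then have "r \<in> p <#\<^bsub>P\<^esub> carrier P" "r \<in> q <#\<^bsub>P\<^esub> carrier P"
        using P.generator_mem_principal by blast+
      then obtain p' q' where p': "p' \<in> carrier P" "p \<otimes>\<^bsub>P\<^esub> p' = r"
        and q': "q' \<in> carrier P" "q \<otimes>\<^bsub>P\<^esub> q' = r"
        by (elim P.principalE) blast
      have "adj C (t p) \<otimes> t q = t p' \<otimes> adj C (t q')"
        using cov pq r meet p' q' unfolding covariant_rep_def by blast
      then have "range_projection t p \<otimes> range_projection t q =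
          (t p \<otimes> t p') \<otimes> adj C (t q \<otimes> t q')"
        using pq p'(1) q'(1) by (simp add: expand adj_mult m_assoc)
      then show "range_projection t p \<otimes> range_projection t q = range_projection t r"
        using pq p' q' by (simp add: isometric_rep_mult[OF assms(2)] range_projection_def)
    qed
  next
    assume proj: ?proj
    have "adj C (t p) \<otimes> t q = t p' \<otimes> adj C (t q')"
      if pq: "p \<in> carrier P" "q \<in> carrier P" and "r \<in> carrier P"
        and p': "p' \<in> carrier P" "p \<otimes>\<^bsub>P\<^esub> p' = r" and q': "q' \<in> carrier P" "q \<otimes>\<^bsub>P\<^esub> q' = r"
        and "(p <#\<^bsub>P\<^esub> carrier P) \<inter> (q <#\<^bsub>P\<^esub> carrier P) = r <#\<^bsub>P\<^esub> carrier P"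
      for p q r p' q'
    proof -
      have "range_projection t p \<otimes> range_projection t q = range_projection t r"
        using proj that by blast
      then have "adj C (t p) \<otimes> t q = adj C (t p) \<otimes> (t r \<otimes> adj C (t r)) \<otimes> t q"
        by (subst collapse) (simp_all add: pq range_projection_def)
      also have "\<dots> = adj C (t p) \<otimes> (t p \<otimes> t p') \<otimes> adj C (adj C (t q) \<otimes> (t q \<otimes> t q'))"
        using pq p' q' \<open>r \<in> carrier P\<close>
        by (simp add: isometric_rep_mult[OF assms(2)] adj_mult adj_adj m_assoc)
      finally show ?thesis using pq p'(1) q'(1) by simp
    qed
    moreover have "adj C (t p) \<otimes> t q = \<zero>"
      if "p \<in> carrier P" "q \<in> carrier P" "(p <#\<^bsub>P\<^esub> carrier P) \<inter> (q <#\<^bsub>P\<^esub> carrier P) = {}" for p q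
      by (subst collapse) (use proj that in simp_all)
    ultimately show ?cov
      using assms(2) unfolding covariant_rep_def by blast
  qed
qed

text \<open>
  It is enough to check covariance for one right LCM of each pair, since the condition on range
  projections is the same for every generator of \<open>pP \<inter> qP\<close>.
\<close>

lemma covariant_repI:
  assumes "monoid P" "isometric_rep P C t"
    and cases: "\<And>p q. p \<in> carrier P \<Longrightarrow> q \<in> carrier P \<Longrightarrow>
      ((p <#\<^bsub>P\<^esub> carrier P) \<inter> (q <#\<^bsub>P\<^esub> carrier P) = {} \<and> adj C (t p) \<otimes> t q = \<zero>) \<or>
      (\<exists>p'\<in>carrier P. \<exists>q'\<in>carrier P. p \<otimes>\<^bsub>P\<^esub> p' = q \<otimes>\<^bsub>P\<^esub> q' \<and>
        (p <#\<^bsub>P\<^esub> carrier P) \<inter> (q <#\<^bsub>P\<^esub> carrier P) = (p \<otimes>\<^bsub>P\<^esub> p') <#\<^bsub>P\<^esub> carrier P \<and>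
        adj C (t p) \<otimes> t q = t p' \<otimes> adj C (t q'))"
  shows "covariant_rep P C t"
  unfolding covariant_rep_iff_range_projection[OF assms(1,2)]
proof (intro ballI)
  interpret P: monoid P by fact
  note iso [simp] = isometric_repD[OF assms(2)]
  fix p q assume pq: "p \<in> carrier P" "q \<in> carrier P"
  have expand: "range_projection t p \<otimes> range_projection t q =
      t p \<otimes> (adj C (t p) \<otimes> t q) \<otimes> adj C (t q)"
    using pq by (simp add: range_projection_def m_assoc)
  from cases[OF pq] show "((p <#\<^bsub>P\<^esub> carrier P) \<inter> (q <#\<^bsub>P\<^esub> carrier P) = {} \<longrightarrow>
        range_projection t p \<otimes> range_projection t q = \<zero>) \<and>
      (\<forall>r\<in>carrier P. (p <#\<^bsub>P\<^esub> carrier P) \<inter> (q <#\<^bsub>P\<^esub> carrier P) = r <#\<^bsub>P\<^esub> carrier P \<longrightarrow>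
        range_projection t p \<otimes> range_projection t q = range_projection t r)"
  proof (elim disjE conjE bexE)
    assume "(p <#\<^bsub>P\<^esub> carrier P) \<inter> (q <#\<^bsub>P\<^esub> carrier P) = {}" "adj C (t p) \<otimes> t q = \<zero>"
    moreover have "p \<in> p <#\<^bsub>P\<^esub> carrier P" if "p \<in> carrier P" for p
      using P.generator_mem_principal that .
    ultimately show ?thesis
      using pq by (auto simp: expand)
  next
    fix p' q' assume p': "p' \<in> carrier P" and q': "q' \<in> carrier P"
      and r: "p \<otimes>\<^bsub>P\<^esub> p' = q \<otimes>\<^bsub>P\<^esub> q'"
      and meet: "(p <#\<^bsub>P\<^esub> carrier P) \<inter> (q <#\<^bsub>P\<^esub> carrier P) = (p \<otimes>\<^bsub>P\<^esub> p') <#\<^bsub>P\<^esub> carrier P"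
      and t: "adj C (t p) \<otimes> t q = t p' \<otimes> adj C (t q')"
    have "range_projection t p \<otimes> range_projection t q = (t p \<otimes> t p') \<otimes> adj C (t q \<otimes> t q')"
      using pq p' q' by (simp add: expand t adj_mult m_assoc)
    also have "\<dots> = range_projection t (p \<otimes>\<^bsub>P\<^esub> p')"
      using pq p' q' r by (simp add: isometric_rep_mult[OF assms(2)] range_projection_def)
    finally have prod: "range_projection t p \<otimes> range_projection t q = range_projection t (p \<otimes>\<^bsub>P\<^esub> p')" .
    have pp': "p \<otimes>\<^bsub>P\<^esub> p' \<in> carrier P" using pq p' by simp
    show ?thesis
    proof (intro conjI impI ballI)
      assume "(p <#\<^bsub>P\<^esub> carrier P) \<inter> (q <#\<^bsub>P\<^esub> carrier P) = {}"
      then show "range_projection t p \<otimes> range_projection t q = \<zero>"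
        using P.generator_mem_principal[OF pp'] unfolding meet by blast
    next
      fix r assume "r \<in> carrier P" "(p <#\<^bsub>P\<^esub> carrier P) \<inter> (q <#\<^bsub>P\<^esub> carrier P) = r <#\<^bsub>P\<^esub> carrier P"
      then show "range_projection t p \<otimes> range_projection t q = range_projection t r"
        unfolding prod meet by (intro range_projection_cong[OF assms(1,2) pp'])
    qed
  qed
qed

text \<open>
  The projections \<open>e\<^sub>X\<close> carry no information beyond the isometries: \<open>e\<^bsub>pP\<^esub> = v\<^sub>pe\<^sub>Pv\<^sub>p\<^sup>* = v\<^sub>pv\<^sub>p\<^sup>*\<close>.
\<close>

lemma li_relations_principal:
  assumes "li_relations P C v e" "p \<in> carrier P"
  shows "e (p <#\<^bsub>P\<^esub> carrier P) = range_projection v p"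
proof -
  have "v p \<otimes> e (carrier P) \<otimes> adj C (v p) = e (p <#\<^bsub>P\<^esub> carrier P)"
    using assms constructible_ideals.whole[of P] unfolding li_relations_def by blast
  then show ?thesis
    using assms by (simp add: li_relations_def range_projection_def isometry_in_def)
qed

lemma li_relations_isometric_rep: "li_relations P C v e \<Longrightarrow> isometric_rep P C v"
  by (simp add: li_relations_def isometric_rep_def)

lemma li_relations_covariant_rep:
  assumes "monoid P" "li_relations P C v e"
  shows "covariant_rep P C v"
proof -
  interpret P: monoid P by fact
  have "range_projection v p \<otimes> range_projection v q = e ((p <#\<^bsub>P\<^esub> carrier P) \<inter> (q <#\<^bsub>P\<^esub> carrier P))"
    if "p \<in> carrier P" "q \<in> carrier P" for p q
    using that assms(2) P.principal_constructible
    by (simp add: li_relations_def flip: li_relations_principal[OF assms(2)])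
  moreover have "e {} = \<zero>" using assms(2) by (simp add: li_relations_def)
  ultimately show ?thesis
    using covariant_rep_iff_range_projection[OF assms(1) li_relations_isometric_rep[OF assms(2)]]
      li_relations_principal[OF assms(2)] by simp
qed

text \<open>
  Conversely, all nonempty constructible ideals are principal, and the range projection of \<open>t\<^sub>p\<close>
  depends on \<open>pP\<close> only, so it may be taken for \<open>e\<^bsub>pP\<^esub>\<close>.
\<close>

lemma covariant_rep_li_relations:
  assumes "right_LCM_semigroup P" "covariant_rep P C t"
  obtains e where "li_relations P C t e"
proof -
  interpret P: monoid P using assms(1) by (simp add: right_LCM_semigroup_def)
  have iso: "isometric_rep P C t" using assms(2) by (simp add: covariant_rep_def)
  note cov = assms(2)[unfolded covariant_rep_iff_range_projection[OF P.monoid_axioms iso]]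
  define e where "e X = (if X = {} then \<zero>
    else range_projection t (SOME p. p \<in> carrier P \<and> X = p <#\<^bsub>P\<^esub> carrier P))" for X
  have e_empty: "e {} = \<zero>" by (simp add: e_def)
  have e_principal: "e (p <#\<^bsub>P\<^esub> carrier P) = range_projection t p" if p: "p \<in> carrier P" for p
  proof -
    define q where "q = (SOME q. q \<in> carrier P \<and> p <#\<^bsub>P\<^esub> carrier P = q <#\<^bsub>P\<^esub> carrier P)"
    have "q \<in> carrier P \<and> p <#\<^bsub>P\<^esub> carrier P = q <#\<^bsub>P\<^esub> carrier P"
      unfolding q_def by (rule someI[of _ p]) (simp add: p)
    then show ?thesis
      using P.generator_mem_principal[OF p] range_projection_cong[OF P.monoid_axioms iso]
      by (auto simp: e_def q_def p)
  qed
  have ideal: "X = {} \<or> (\<exists>p\<in>carrier P. X = p <#\<^bsub>P\<^esub> carrier P)" if "X \<in> constructible_ideals P" for X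
    using right_LCM_constructible_principal[OF assms(1) that] .
  have e_proj: "projection_in C (e X)" if "X \<in> constructible_ideals P" for X
    using ideal[OF that] projection_range_projection[OF iso]
    by (auto simp: e_principal e_empty) (simp add: projection_in_def adj_zero)
  have e_translate: "t p \<otimes> e X \<otimes> adj C (t p) = e (p <#\<^bsub>P\<^esub> X)"
    if p: "p \<in> carrier P" and X: "X \<in> constructible_ideals P" for p X
    using ideal[OF X]
  proof (elim disjE bexE)
    assume "X = {}"
    then show ?thesis
      using isometric_repD[OF iso p] by (simp add: e_empty l_coset_def)
  next
    fix q assume q: "q \<in> carrier P" "X = q <#\<^bsub>P\<^esub> carrier P"
    have "t (p \<otimes>\<^bsub>P\<^esub> q) = t p \<otimes> t q" using isometric_rep_mult[OF iso p q(1)] by simp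
    then show ?thesis
      using isometric_repD[OF iso p] isometric_repD[OF iso q(1)] p q(1)
      by (simp add: q(2) P.principal_translate e_principal range_projection_def adj_mult m_assoc)
  qed
  have e_inter: "e X \<otimes> e Y = e (X \<inter> Y)"
    if X: "X \<in> constructible_ideals P" and Y: "Y \<in> constructible_ideals P" for X Y
  proof (cases "X = {} \<or> Y = {}")
    case True
    then show ?thesis
      using e_proj[OF X] e_proj[OF Y] by (auto simp: e_empty projection_in_def)
  next
    case False
    then obtain p q where p: "p \<in> carrier P" "X = p <#\<^bsub>P\<^esub> carrier P"
      and q: "q \<in> carrier P" "Y = q <#\<^bsub>P\<^esub> carrier P"
      using ideal[OF X] ideal[OF Y] by auto
    show ?thesis
      using ideal[OF constructible_ideals.inter[OF X Y]] cov p q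
      by (auto simp: e_principal e_empty)
  qed
  have "e (carrier P) = \<one>"
    using e_principal[of "\<one>\<^bsub>P\<^esub>"] isometric_rep_one[OF P.monoid_axioms iso]
    by (simp add: P.principal_one range_projection_def adj_one)
  then have "li_relations P C t e"
    using iso e_proj e_translate e_inter e_empty
    by (simp add: li_relations_def isometric_rep_def)
  then show ?thesis by (rule that)
qed

end


section \<open>Ideals of the Zappa--Szep product\<close>

context zappa_szep_maps
begin

abbreviation ZS :: "('u \<times> 'a) monoid" where
  "ZS \<equiv> zappa_szep U A act res"

lemma ZS_carrier [simp]: "(u, a) \<in> carrier ZS \<longleftrightarrow> u \<in> carrier U \<and> a \<in> carrier A"
  by (simp add: zappa_szep_def)

lemma ZS_mult [simp]:
  "(u, a) \<otimes>\<^bsub>ZS\<^esub> (v, b) = (u \<otimes>\<^bsub>U\<^esub> act a v, res a v \<otimes>\<^bsub>A\<^esub> b)"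
  by (simp add: zappa_szep_def)

lemma ZS_one [simp]: "\<one>\<^bsub>ZS\<^esub> = (\<one>\<^bsub>U\<^esub>, \<one>\<^bsub>A\<^esub>)"
  by (simp add: zappa_szep_def)

lemma monoid_ZS: "monoid ZS"
proof (rule monoidI)
  fix p q r assume "p \<in> carrier ZS" "q \<in> carrier ZS" "r \<in> carrier ZS"
  then show "(p \<otimes>\<^bsub>ZS\<^esub> q) \<otimes>\<^bsub>ZS\<^esub> r = p \<otimes>\<^bsub>ZS\<^esub> (q \<otimes>\<^bsub>ZS\<^esub> r)"
    by (cases p; cases q; cases r)
      (simp add: act_closed res_closed B2 B5 B6 B8 U.m_assoc A.m_assoc)
qed (auto simp: act_closed res_closed B1 B3 B4 B7)

end

sublocale zappa_szep_maps \<subseteq> ZS: monoid ZS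
  by (rule monoid_ZS)

locale right_LCM_zappa_szep = zappa_szep_maps U A act res
  for U :: "('u, 'm) monoid_scheme" and A :: "('a, 'n) monoid_scheme"
    and act :: "'a \<Rightarrow> 'u \<Rightarrow> 'u" and res :: "'a \<Rightarrow> 'u \<Rightarrow> 'a" +
  assumes right_LCM_U: "right_LCM_semigroup U"
    and left_cancellative_A: "left_cancellative A"
    and ideals_A_chain:
      "\<And>X Y. X \<in> constructible_ideals A \<Longrightarrow> Y \<in> constructible_ideals A \<Longrightarrow> X \<subseteq> Y \<or> Y \<subseteq> X"
    and act_bij: "\<And>a. a \<in> carrier A \<Longrightarrow> bij_betw (act a) (carrier U) (carrier U)"
begin

lemma U_cancel:
  "u \<otimes>\<^bsub>U\<^esub> x = u \<otimes>\<^bsub>U\<^esub> y \<Longrightarrow> u \<in> carrier U \<Longrightarrow> x \<in> carrier U \<Longrightarrow> y \<in> carrier U \<Longrightarrow> x = y"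
  using right_LCM_U unfolding right_LCM_semigroup_def left_cancellative_def by blast

lemma A_cancel:
  "a \<otimes>\<^bsub>A\<^esub> x = a \<otimes>\<^bsub>A\<^esub> y \<Longrightarrow> a \<in> carrier A \<Longrightarrow> x \<in> carrier A \<Longrightarrow> y \<in> carrier A \<Longrightarrow> x = y"
  using left_cancellative_A unfolding left_cancellative_def by blast

lemma act_inj:
  "act a x = act a y \<Longrightarrow> a \<in> carrier A \<Longrightarrow> x \<in> carrier U \<Longrightarrow> y \<in> carrier U \<Longrightarrow> x = y"
  using act_bij by (auto simp: bij_betw_def inj_on_def)

lemma act_surj:
  assumes "a \<in> carrier A" "u \<in> carrier U"
  obtains z where "z \<in> carrier U" "act a z = u"
  using act_bij[OF assms(1)] assms(2) by (force simp: bij_betw_def)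

lemma A_comparable:
  assumes "c \<in> carrier A" "d \<in> carrier A"
  shows "(\<exists>x\<in>carrier A. d = c \<otimes>\<^bsub>A\<^esub> x) \<or> (\<exists>x\<in>carrier A. c = d \<otimes>\<^bsub>A\<^esub> x)"
proof -
  have "d \<in> c <#\<^bsub>A\<^esub> carrier A \<or> c \<in> d <#\<^bsub>A\<^esub> carrier A"
    using ideals_A_chain[OF A.principal_constructible[OF assms(1)] A.principal_constructible[OF assms(2)]]
      A.generator_mem_principal[OF assms(1)] A.generator_mem_principal[OF assms(2)] by blast
  then show ?thesis by (auto elim!: A.principalE)
qed

lemma ZS_left_cancellative: "left_cancellative ZS"
  unfolding left_cancellative_def
proof (intro ballI impI)
  fix p q r assume carr: "p \<in> carrier ZS" "q \<in> carrier ZS" "r \<in> carrier ZS"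
    and eq: "p \<otimes>\<^bsub>ZS\<^esub> q = p \<otimes>\<^bsub>ZS\<^esub> r"
  obtain u a v b w c where pqr: "p = (u, a)" "q = (v, b)" "r = (w, c)" by (metis surj_pair)
  have "act a v = act a w"
    by (rule U_cancel[of u]) (use carr eq act_closed in \<open>auto simp: pqr\<close>)
  then have "v = w"
    by (rule act_inj) (use carr in \<open>auto simp: pqr\<close>)
  have "b = c"
    by (rule A_cancel[of "res a v"]) (use carr eq res_closed \<open>v = w\<close> in \<open>auto simp: pqr\<close>)
  with \<open>v = w\<close> show "q = r" by (simp add: pqr)
qed

lemma ZS_ideal_fst:
  assumes "u \<in> carrier U" "a \<in> carrier A"
  shows "(u, a) <#\<^bsub>ZS\<^esub> carrier ZS \<subseteq> (u <#\<^bsub>U\<^esub> carrier U) \<times> UNIV"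
proof
  fix g assume "g \<in> (u, a) <#\<^bsub>ZS\<^esub> carrier ZS"
  then obtain y k where "(y, k) \<in> carrier ZS" "(u, a) \<otimes>\<^bsub>ZS\<^esub> (y, k) = g"
    by (metis ZS.principalE surj_pair)
  then show "g \<in> (u <#\<^bsub>U\<^esub> carrier U) \<times> UNIV"
    using act_closed[OF assms(2)] by (auto simp: l_coset_def)
qed

text \<open>
  Cutting the ideal of \<open>(v, b)\<close> down to first coordinates in \<open>wU\<close> leaves a principal ideal:
  \<open>v(b\<cdot>x) \<in> v(b\<cdot>y)U\<close> forces \<open>b\<cdot>x \<in> (b\<cdot>y)U\<close>, and as \<open>b|\<^sub>y\<close> acts surjectively, (B5) and
  injectivity of \<open>b\<close> turn this into \<open>x \<in> yU\<close>.
\<close>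

lemma ZS_ideal_strip:
  assumes carr: "v \<in> carrier U" "b \<in> carrier A" "y \<in> carrier U" and w: "v \<otimes>\<^bsub>U\<^esub> act b y = w"
  shows "((v, b) <#\<^bsub>ZS\<^esub> carrier ZS) \<inter> (w <#\<^bsub>U\<^esub> carrier U) \<times> UNIV = (w, res b y) <#\<^bsub>ZS\<^esub> carrier ZS"
    (is "?L = ?R")
proof
  have wU: "w \<in> carrier U" using carr act_closed w by auto
  have eq: "(w, res b y) = (v, b) \<otimes>\<^bsub>ZS\<^esub> (y, \<one>\<^bsub>A\<^esub>)"
    using carr res_closed by (simp add: w)
  have "?R \<subseteq> (v, b) <#\<^bsub>ZS\<^esub> carrier ZS"
    unfolding eq using carr by (intro ZS.principal_mult_subset) auto
  moreover have "?R \<subseteq> (w <#\<^bsub>U\<^esub> carrier U) \<times> UNIV"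
    using ZS_ideal_fst[OF wU res_closed[OF carr(2,3)]] .
  ultimately show "?R \<subseteq> ?L" by blast
  show "?L \<subseteq> ?R"
  proof
    fix g assume g: "g \<in> ?L"
    then obtain x h where xh: "x \<in> carrier U" "h \<in> carrier A"
      and g_eq: "g = (v \<otimes>\<^bsub>U\<^esub> act b x, res b x \<otimes>\<^bsub>A\<^esub> h)"
      by (metis IntE ZS.principalE ZS_carrier ZS_mult surj_pair)
    obtain m where m: "m \<in> carrier U" "w \<otimes>\<^bsub>U\<^esub> m = v \<otimes>\<^bsub>U\<^esub> act b x"
      using g g_eq by (auto elim: U.principalE)
    obtain m' where m': "m' \<in> carrier U" "act (res b y) m' = m"
      using act_surj[OF res_closed[OF carr(2,3)] m(1)] .
    have "act b x = act b y \<otimes>\<^bsub>U\<^esub> m"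
      by (rule U_cancel[of v]) (use carr xh m act_closed in \<open>auto simp: U.m_assoc simp flip: w\<close>)
    then have "act b x = act b (y \<otimes>\<^bsub>U\<^esub> m')"
      using carr m' by (simp add: B5)
    then have "x = y \<otimes>\<^bsub>U\<^esub> m'"
      by (rule act_inj) (use carr xh m' in auto)
    then have "g = (w, res b y) \<otimes>\<^bsub>ZS\<^esub> (m', h)"
      using carr m m' by (simp add: g_eq B6)
    moreover have "(m', h) \<in> carrier ZS" using m' xh by simp
    ultimately show "g \<in> ?R" unfolding l_coset_def by blast
  qed
qed

text \<open>
  The intersection lives over \<open>wU\<close>, where the two ideals become \<open>(w, a|\<^sub>z)P\<close> and \<open>(w, b|\<^sub>y)P\<close>.  If
  \<open>b|\<^sub>y = a|\<^sub>z x\<close>, then \<open>(w, b|\<^sub>y) = (w, a|\<^sub>z)(1, x)\<close>, so the second ideal lies in the first and is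
  the intersection.
\<close>

lemma ZS_common_multiple:
  assumes uv: "u \<in> carrier U" "v \<in> carrier U" and ab: "a \<in> carrier A" "b \<in> carrier A"
    and zy: "z \<in> carrier U" "y \<in> carrier U" and x: "x \<in> carrier A"
    and meet: "(u <#\<^bsub>U\<^esub> carrier U) \<inter> (v <#\<^bsub>U\<^esub> carrier U) = w <#\<^bsub>U\<^esub> carrier U"
    and w: "u \<otimes>\<^bsub>U\<^esub> act a z = w" "v \<otimes>\<^bsub>U\<^esub> act b y = w"
    and rem: "res b y = res a z \<otimes>\<^bsub>A\<^esub> x"
  shows "(u, a) \<otimes>\<^bsub>ZS\<^esub> (z, x) = (v, b) \<otimes>\<^bsub>ZS\<^esub> (y, \<one>\<^bsub>A\<^esub>)"
    and "((u, a) <#\<^bsub>ZS\<^esub> carrier ZS) \<inter> ((v, b) <#\<^bsub>ZS\<^esub> carrier ZS) =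
      ((u, a) \<otimes>\<^bsub>ZS\<^esub> (z, x)) <#\<^bsub>ZS\<^esub> carrier ZS"
proof -
  show "(u, a) \<otimes>\<^bsub>ZS\<^esub> (z, x) = (v, b) \<otimes>\<^bsub>ZS\<^esub> (y, \<one>\<^bsub>A\<^esub>)"
    using ab zy x res_closed by (simp add: w rem)
  have wU: "w \<in> carrier U" using uv ab zy act_closed w by auto
  have c: "res a z \<in> carrier A" using ab zy res_closed by simp
  have r: "(u, a) \<otimes>\<^bsub>ZS\<^esub> (z, x) = (w, res a z) \<otimes>\<^bsub>ZS\<^esub> (\<one>\<^bsub>U\<^esub>, x)"
    using wU c by (simp add: w B3 B4)
  have r': "(u, a) \<otimes>\<^bsub>ZS\<^esub> (z, x) = (w, res b y)" by (simp add: w rem)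
  have "((u, a) <#\<^bsub>ZS\<^esub> carrier ZS) \<inter> ((v, b) <#\<^bsub>ZS\<^esub> carrier ZS) \<subseteq> (w <#\<^bsub>U\<^esub> carrier U) \<times> UNIV"
    using ZS_ideal_fst[OF uv(1) ab(1)] ZS_ideal_fst[OF uv(2) ab(2)] meet by blast
  then have "((u, a) <#\<^bsub>ZS\<^esub> carrier ZS) \<inter> ((v, b) <#\<^bsub>ZS\<^esub> carrier ZS) =
      ((w, res a z) <#\<^bsub>ZS\<^esub> carrier ZS) \<inter> ((w, res b y) <#\<^bsub>ZS\<^esub> carrier ZS)"
    using ZS_ideal_strip[OF uv(1) ab(1) zy(1) w(1)] ZS_ideal_strip[OF uv(2) ab(2) zy(2) w(2)] by blast
  moreover have "(w, res b y) <#\<^bsub>ZS\<^esub> carrier ZS \<subseteq> (w, res a z) <#\<^bsub>ZS\<^esub> carrier ZS"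
    unfolding r'[symmetric] r using wU c x by (intro ZS.principal_mult_subset) auto
  ultimately show "((u, a) <#\<^bsub>ZS\<^esub> carrier ZS) \<inter> ((v, b) <#\<^bsub>ZS\<^esub> carrier ZS) =
      ((u, a) \<otimes>\<^bsub>ZS\<^esub> (z, x)) <#\<^bsub>ZS\<^esub> carrier ZS"
    unfolding r' by blast
qed

text \<open>
  The disjoint case is decided in \<open>U\<close>.  Otherwise surjectivity of the action allows the
  right LCM \<open>w\<close> of \<open>u\<close> and \<open>v\<close> to be reached from both \<open>(u, a)\<close> and \<open>(v, b)\<close>, and the chain
  condition on \<open>A\<close> makes the remainders comparable.
\<close>

lemma ZS_ideal_cases:
  assumes uv: "u \<in> carrier U" "v \<in> carrier U" and ab: "a \<in> carrier A" "b \<in> carrier A"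
  obtains
    (disjoint) "(u <#\<^bsub>U\<^esub> carrier U) \<inter> (v <#\<^bsub>U\<^esub> carrier U) = {}"
      "((u, a) <#\<^bsub>ZS\<^esub> carrier ZS) \<inter> ((v, b) <#\<^bsub>ZS\<^esub> carrier ZS) = {}"
  | (meet) w z y x where "w \<in> carrier U" "z \<in> carrier U" "y \<in> carrier U" "x \<in> carrier A"
      "(u <#\<^bsub>U\<^esub> carrier U) \<inter> (v <#\<^bsub>U\<^esub> carrier U) = w <#\<^bsub>U\<^esub> carrier U"
      "u \<otimes>\<^bsub>U\<^esub> act a z = w" "v \<otimes>\<^bsub>U\<^esub> act b y = w"
      "res b y = res a z \<otimes>\<^bsub>A\<^esub> x \<or> res a z = res b y \<otimes>\<^bsub>A\<^esub> x"
proof -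
  consider "(u <#\<^bsub>U\<^esub> carrier U) \<inter> (v <#\<^bsub>U\<^esub> carrier U) = {}"
    | w where "w \<in> carrier U" "(u <#\<^bsub>U\<^esub> carrier U) \<inter> (v <#\<^bsub>U\<^esub> carrier U) = w <#\<^bsub>U\<^esub> carrier U"
    using right_LCM_U uv unfolding right_LCM_semigroup_iff by blast
  then show thesis
  proof cases
    case 1
    moreover have "((u, a) <#\<^bsub>ZS\<^esub> carrier ZS) \<inter> ((v, b) <#\<^bsub>ZS\<^esub> carrier ZS) = {}"
      using ZS_ideal_fst[OF uv(1) ab(1)] ZS_ideal_fst[OF uv(2) ab(2)] 1 by blast
    ultimately show thesis by (rule disjoint)
  next
    case 2
    then have "w \<in> u <#\<^bsub>U\<^esub> carrier U" "w \<in> v <#\<^bsub>U\<^esub> carrier U"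
      using U.generator_mem_principal by blast+
    then obtain u' v' where "u' \<in> carrier U" "u \<otimes>\<^bsub>U\<^esub> u' = w" "v' \<in> carrier U" "v \<otimes>\<^bsub>U\<^esub> v' = w"
      by (elim U.principalE) blast
    moreover obtain z where "z \<in> carrier U" "act a z = u'" using act_surj[OF ab(1) \<open>u' \<in> _\<close>] .
    moreover obtain y where "y \<in> carrier U" "act b y = v'" using act_surj[OF ab(2) \<open>v' \<in> _\<close>] .
    ultimately show thesis
      using A_comparable[of "res a z" "res b y"] ab res_closed 2 by (metis meet)
  qed
qed

lemma right_LCM_ZS: "right_LCM_semigroup ZS"
  unfolding right_LCM_semigroup_iff
proof (intro conjI ballI)
  fix p q assume "p \<in> carrier ZS" "q \<in> carrier ZS"
  then obtain u a v b where p: "p = (u, a)" "u \<in> carrier U" "a \<in> carrier A"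
    and q: "q = (v, b)" "v \<in> carrier U" "b \<in> carrier A"
    by (metis ZS_carrier surj_pair)
  show "(p <#\<^bsub>ZS\<^esub> carrier ZS) \<inter> (q <#\<^bsub>ZS\<^esub> carrier ZS) = {} \<or>
      (\<exists>r\<in>carrier ZS. (p <#\<^bsub>ZS\<^esub> carrier ZS) \<inter> (q <#\<^bsub>ZS\<^esub> carrier ZS) = r <#\<^bsub>ZS\<^esub> carrier ZS)"
    using p(2) q(2) p(3) q(3)
  proof (cases rule: ZS_ideal_cases)
    case disjoint
    then show ?thesis by (simp add: p(1) q(1))
  next
    case (meet w z y x)
    have closed: "(u, a) \<otimes>\<^bsub>ZS\<^esub> (z, x) \<in> carrier ZS" "(v, b) \<otimes>\<^bsub>ZS\<^esub> (y, x) \<in> carrier ZS"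
      using p q meet(1-4) by (simp_all add: act_closed res_closed)
    from meet(8) show ?thesis
    proof
      assume "res b y = res a z \<otimes>\<^bsub>A\<^esub> x"
      from ZS_common_multiple(2)[OF p(2) q(2) p(3) q(3) meet(2-7) this] closed(1)
      show ?thesis unfolding p(1) q(1) by blast
    next
      assume "res a z = res b y \<otimes>\<^bsub>A\<^esub> x"
      from ZS_common_multiple(2)[OF q(2) p(2) q(3) p(3) meet(3,2,4) _ meet(7,6) this] meet(5) closed(2)
      show ?thesis unfolding p(1) q(1) by (metis Int_commute)
    qed
  qed
qed (simp_all add: monoid_ZS ZS_left_cancellative)

section \<open>Representations of the factors and of the product\<close>

text \<open>
  By covariance of \<open>t\<close>, then (K2) on the left and its adjoint on the right,
  \<open>(t\<^sub>us\<^sub>a)\<^sup>*t\<^sub>vs\<^sub>b = s\<^sub>a\<^sup>*t\<^bsub>a\<cdot>z\<^esub>t\<^bsub>b\<cdot>y\<^esub>\<^sup>*s\<^sub>b = t\<^sub>zs\<^sub>c\<^sup>*s\<^sub>dt\<^sub>y\<^sup>*\<close> with \<open>c = a|\<^sub>z\<close> and \<open>d = b|\<^sub>y\<close>;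
  comparability of \<open>c\<close> and \<open>d\<close> reduces \<open>s\<^sub>c\<^sup>*s\<^sub>d\<close> to \<open>s\<^sub>x\<close> or to \<open>s\<^sub>x\<^sup>*\<close>.
\<close>

lemma zs_relations_adj_mult:
  fixes D :: "'c cstar_algebra" (structure)
  assumes "cstar_algebra D" and rel: "zs_relations U A act res D s t"
    and uv: "u \<in> carrier U" "v \<in> carrier U" and ab: "a \<in> carrier A" "b \<in> carrier A"
    and zy: "z \<in> carrier U" "y \<in> carrier U" and x: "x \<in> carrier A"
    and meet: "(u <#\<^bsub>U\<^esub> carrier U) \<inter> (v <#\<^bsub>U\<^esub> carrier U) = w <#\<^bsub>U\<^esub> carrier U"
    and w: "u \<otimes>\<^bsub>U\<^esub> act a z = w" "v \<otimes>\<^bsub>U\<^esub> act b y = w"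
    and rem: "res b y = res a z \<otimes>\<^bsub>A\<^esub> x"
  shows "adj D (t u \<otimes> s a) \<otimes> (t v \<otimes> s b) = (t z \<otimes> s x) \<otimes> adj D (t y \<otimes> s \<one>\<^bsub>A\<^esub>)"
proof -
  interpret D: cstar_algebra D by fact
  have s: "isometric_rep A D s" and cov: "covariant_rep U D t"
    using rel by (simp_all add: zs_relations_def)
  then have t: "isometric_rep U D t" by (simp add: covariant_rep_def)
  note iso [simp] = D.isometric_repD[OF s] D.isometric_rep_cancel[OF s]
    D.isometric_repD[OF t] D.isometric_rep_cancel[OF t]
  note [simp] = D.m_assoc act_closed res_closed D.adj_mult D.adj_adj
  have wU: "w \<in> carrier U" using uv ab zy w by auto
  have K2: "adj D (s a') \<otimes> t (act a' z') = t z' \<otimes> adj D (s (res a' z'))"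
    if "a' \<in> carrier A" "z' \<in> carrier U" for a' z'
    using rel that act_closed unfolding zs_relations_def by blast
  have t_cov: "adj D (t u) \<otimes> t v = t (act a z) \<otimes> adj D (t (act b y))"
    using cov uv wU meet w zy ab act_closed unfolding covariant_rep_def by blast
  have right: "adj D (t (act b y)) \<otimes> s b = s (res b y) \<otimes> adj D (t y)"
    using arg_cong[OF K2[OF ab(2) zy(2)], of "adj D"] ab zy by simp
  have rest: "s (res b y) = s (res a z) \<otimes> s x"
    unfolding rem using ab zy x by (simp add: D.isometric_rep_mult[OF s])
  have "adj D (t u \<otimes> s a) \<otimes> (t v \<otimes> s b) = adj D (s a) \<otimes> (adj D (t u) \<otimes> t v) \<otimes> s b"
    using uv ab by simp
  also have "\<dots> = (adj D (s a) \<otimes> t (act a z)) \<otimes> (adj D (t (act b y)) \<otimes> s b)"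
    unfolding t_cov using uv ab zy by simp
  also have "\<dots> = t z \<otimes> s x \<otimes> adj D (t y)"
    unfolding K2[OF ab(1) zy(1)] right rest using ab zy x by simp
  finally show ?thesis
    using zy x by (simp add: D.isometric_rep_one[OF A.monoid_axioms s])
qed

lemma zs_relations_covariant_rep:
  fixes D :: "'c cstar_algebra" (structure)
  assumes "cstar_algebra D" and rel: "zs_relations U A act res D s t"
  shows "covariant_rep ZS D (\<lambda>(u, a). t u \<otimes> s a)"
proof -
  interpret D: cstar_algebra D by fact
  let ?V = "\<lambda>(u, a). t u \<otimes> s a"
  have s: "isometric_rep A D s" and cov: "covariant_rep U D t"
    and K1: "\<And>a u. a \<in> carrier A \<Longrightarrow> u \<in> carrier U \<Longrightarrow> s a \<otimes> t u = t (act a u) \<otimes> s (res a u)"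
    using rel by (simp_all add: zs_relations_def)
  then have t: "isometric_rep U D t" by (simp add: covariant_rep_def)
  note iso [simp] = D.isometric_repD[OF s] D.isometric_rep_cancel[OF s]
    D.isometric_repD[OF t] D.isometric_rep_cancel[OF t]
  have V: "isometric_rep ZS D ?V"
    unfolding isometric_rep_def
  proof (intro conjI ballI)
    fix p assume "p \<in> carrier ZS"
    then show "isometry_in D (?V p)"
      by (cases p) (simp add: isometry_in_def D.adj_mult D.m_assoc)
  next
    fix p q assume "p \<in> carrier ZS" "q \<in> carrier ZS"
    then obtain u a v b where p: "p = (u, a)" "u \<in> carrier U" "a \<in> carrier A"
      and q: "q = (v, b)" "v \<in> carrier U" "b \<in> carrier A"
      by (metis ZS_carrier surj_pair)
    have "?V p \<otimes> ?V q = t u \<otimes> (s a \<otimes> t v) \<otimes> s b"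
      using p q by (simp add: D.m_assoc)
    also have "\<dots> = (t u \<otimes> t (act a v)) \<otimes> (s (res a v) \<otimes> s b)"
      using p q act_closed res_closed by (simp add: K1 D.m_assoc)
    also have "\<dots> = ?V (p \<otimes>\<^bsub>ZS\<^esub> q)"
      using p q act_closed res_closed by (simp add: D.isometric_rep_mult[OF s] D.isometric_rep_mult[OF t])
    finally show "?V p \<otimes> ?V q = ?V (p \<otimes>\<^bsub>ZS\<^esub> q)" .
  qed
  show ?thesis
  proof (rule D.covariant_repI[OF monoid_ZS V])
    fix p q assume "p \<in> carrier ZS" "q \<in> carrier ZS"
    then obtain u a v b where p: "p = (u, a)" "u \<in> carrier U" "a \<in> carrier A"
      and q: "q = (v, b)" "v \<in> carrier U" "b \<in> carrier A"
      by (metis ZS_carrier surj_pair)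
    show "((p <#\<^bsub>ZS\<^esub> carrier ZS) \<inter> (q <#\<^bsub>ZS\<^esub> carrier ZS) = {} \<and> adj D (?V p) \<otimes> ?V q = \<zero>) \<or>
      (\<exists>p'\<in>carrier ZS. \<exists>q'\<in>carrier ZS. p \<otimes>\<^bsub>ZS\<^esub> p' = q \<otimes>\<^bsub>ZS\<^esub> q' \<and>
        (p <#\<^bsub>ZS\<^esub> carrier ZS) \<inter> (q <#\<^bsub>ZS\<^esub> carrier ZS) = (p \<otimes>\<^bsub>ZS\<^esub> p') <#\<^bsub>ZS\<^esub> carrier ZS \<and>
        adj D (?V p) \<otimes> ?V q = ?V p' \<otimes> adj D (?V q'))"
      (is "?disjoint \<or> ?meet")
      using p(2) q(2) p(3) q(3)
    proof (cases rule: ZS_ideal_cases)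
      case disjoint
      have "adj D (?V p) \<otimes> ?V q = adj D (s a) \<otimes> (adj D (t u) \<otimes> t v) \<otimes> s b"
        using p q by (simp add: D.adj_mult D.m_assoc)
      also have "adj D (t u) \<otimes> t v = \<zero>"
        using cov p(2) q(2) disjoint(1) unfolding covariant_rep_def by blast
      finally have ?disjoint using p q disjoint(2) by simp
      then show ?thesis ..
    next
      case (meet w z y x)
      have closed: "(z, x) \<in> carrier ZS" "(y, x) \<in> carrier ZS" "(z, \<one>\<^bsub>A\<^esub>) \<in> carrier ZS" "(y, \<one>\<^bsub>A\<^esub>) \<in> carrier ZS"
        using meet by simp_all
      from meet(8) have ?meet
      proof
        assume "res b y = res a z \<otimes>\<^bsub>A\<^esub> x"
        note arg = p(2) q(2) p(3) q(3) meet(2-7) this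
        show ?meet
          unfolding p(1) q(1)
          using ZS_common_multiple[OF arg] zs_relations_adj_mult[OF assms arg]
          by (intro bexI[OF _ closed(1)] bexI[OF _ closed(4)]) simp
      next
        assume "res a z = res b y \<otimes>\<^bsub>A\<^esub> x"
        note arg = q(2) p(2) q(3) p(3) meet(3,2,4) meet(5)[unfolded Int_commute[of "u <#\<^bsub>U\<^esub> _"]]
          meet(7,6) this
        have V_carr: "?V p' \<in> carrier D" if "p' \<in> carrier ZS" for p'
          using D.isometric_repD(1)[OF V that] .
        \<comment> \<open>The previous case computes the product in the other order; its adjoint is the one needed here.\<close>
        have "adj D (?V p) \<otimes> ?V q = adj D (adj D (?V q) \<otimes> ?V p)"
          using p q by (simp add: D.adj_mult D.adj_adj D.adj_closed)
        also have "\<dots> = adj D (?V (y, x) \<otimes> adj D (?V (z, \<one>\<^bsub>A\<^esub>)))"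
          using zs_relations_adj_mult[OF assms arg] by (simp add: p(1) q(1))
        also have "\<dots> = ?V (z, \<one>\<^bsub>A\<^esub>) \<otimes> adj D (?V (y, x))"
          using V_carr[OF closed(2)] V_carr[OF closed(3)]
          by (simp only: D.adj_mult D.adj_adj D.adj_closed)
        finally show ?meet
          using ZS_common_multiple[OF arg] unfolding p(1) q(1)
          by (intro bexI[OF _ closed(3)] bexI[OF _ closed(2)]) (simp only: Int_commute simp_thms)
      qed
      then show ?thesis ..
    qed
  qed
qed

text \<open>
  Both (K1) and (K2) are shadows of the factorisation \<open>(1, a)(u, 1) = (a\<cdot>u, 1)(1, a|\<^sub>u)\<close>: (K1) is its
  image, and (K2) is covariance for the pair \<open>(1, a)\<close>, \<open>(a\<cdot>z, 1)\<close>, whose right LCM is the element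
  \<open>(1, a)(z, 1) = (a\<cdot>z, 1)(1, a|\<^sub>z)\<close>.
\<close>

lemma covariant_rep_zs_relations:
  fixes D :: "'c cstar_algebra" (structure)
  assumes "cstar_algebra D" and V: "covariant_rep ZS D V"
  shows "zs_relations U A act res D (\<lambda>a. V (\<one>\<^bsub>U\<^esub>, a)) (\<lambda>u. V (u, \<one>\<^bsub>A\<^esub>))"
proof -
  interpret D: cstar_algebra D by fact
  have iso: "isometric_rep ZS D V" using V by (simp add: covariant_rep_def)
  have V_mult: "V (u, a) \<otimes> V (v, b) = V (u \<otimes>\<^bsub>U\<^esub> act a v, res a v \<otimes>\<^bsub>A\<^esub> b)"
    if "u \<in> carrier U" "a \<in> carrier A" "v \<in> carrier U" "b \<in> carrier A" for u a v b
    using D.isometric_rep_mult[OF iso, of "(u, a)" "(v, b)"] that by simp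
  have V_iso: "isometry_in D (V (u, a))" if "u \<in> carrier U" "a \<in> carrier A" for u a
    using iso that by (simp add: isometric_rep_def)
  have cov: "adj D (V p) \<otimes> V q = V p' \<otimes> adj D (V q')"
    if "(p <#\<^bsub>ZS\<^esub> carrier ZS) \<inter> (q <#\<^bsub>ZS\<^esub> carrier ZS) = r <#\<^bsub>ZS\<^esub> carrier ZS"
      "p \<otimes>\<^bsub>ZS\<^esub> p' = r" "q \<otimes>\<^bsub>ZS\<^esub> q' = r"
      "p \<in> carrier ZS" "q \<in> carrier ZS" "r \<in> carrier ZS" "p' \<in> carrier ZS" "q' \<in> carrier ZS"
    for p q r p' q'
    using V that unfolding covariant_rep_def by blast
  have U_ideal: "(u, \<one>\<^bsub>A\<^esub>) <#\<^bsub>ZS\<^esub> carrier ZS = (u <#\<^bsub>U\<^esub> carrier U) \<times> carrier A"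
    if "u \<in> carrier U" for u
  proof
    show "(u, \<one>\<^bsub>A\<^esub>) <#\<^bsub>ZS\<^esub> carrier ZS \<subseteq> (u <#\<^bsub>U\<^esub> carrier U) \<times> carrier A"
      using ZS_ideal_fst[OF that A.one_closed] ZS.principal_subset_carrier[of "(u, \<one>\<^bsub>A\<^esub>)"] that
      by fastforce
    show "(u <#\<^bsub>U\<^esub> carrier U) \<times> carrier A \<subseteq> (u, \<one>\<^bsub>A\<^esub>) <#\<^bsub>ZS\<^esub> carrier ZS"
    proof (clarify elim!: U.principalE)
      fix y b assume "y \<in> carrier U" "b \<in> carrier A"
      then have "(u \<otimes>\<^bsub>U\<^esub> y, b) = (u, \<one>\<^bsub>A\<^esub>) \<otimes>\<^bsub>ZS\<^esub> (y, b)" "(y, b) \<in> carrier ZS"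
        by (simp_all add: B1 B7)
      then show "(u \<otimes>\<^bsub>U\<^esub> y, b) \<in> (u, \<one>\<^bsub>A\<^esub>) <#\<^bsub>ZS\<^esub> carrier ZS"
        unfolding l_coset_def by blast
    qed
  qed
  have "covariant_rep U D (\<lambda>u. V (u, \<one>\<^bsub>A\<^esub>))"
    unfolding covariant_rep_def isometric_rep_def
  proof (intro conjI ballI impI)
    fix u v assume "u \<in> carrier U" "v \<in> carrier U"
    then show "V (u, \<one>\<^bsub>A\<^esub>) \<otimes> V (v, \<one>\<^bsub>A\<^esub>) = V (u \<otimes>\<^bsub>U\<^esub> v, \<one>\<^bsub>A\<^esub>)"
      by (simp add: V_mult B1 B7)
  next
    fix u v w u' v' assume carr: "u \<in> carrier U" "v \<in> carrier U" "w \<in> carrier U" "u' \<in> carrier U" "v' \<in> carrier U"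
      and "(u <#\<^bsub>U\<^esub> carrier U) \<inter> (v <#\<^bsub>U\<^esub> carrier U) = w <#\<^bsub>U\<^esub> carrier U \<and> u \<otimes>\<^bsub>U\<^esub> u' = w \<and> v \<otimes>\<^bsub>U\<^esub> v' = w"
    moreover from this have "((u, \<one>\<^bsub>A\<^esub>) <#\<^bsub>ZS\<^esub> carrier ZS) \<inter> ((v, \<one>\<^bsub>A\<^esub>) <#\<^bsub>ZS\<^esub> carrier ZS)
        = (w, \<one>\<^bsub>A\<^esub>) <#\<^bsub>ZS\<^esub> carrier ZS"
      by (simp add: U_ideal flip: Times_Int_distrib1)
    ultimately show "adj D (V (u, \<one>\<^bsub>A\<^esub>)) \<otimes> V (v, \<one>\<^bsub>A\<^esub>) = V (u', \<one>\<^bsub>A\<^esub>) \<otimes> adj D (V (v', \<one>\<^bsub>A\<^esub>))"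
      by (intro cov) (auto simp: B1 B7)
  next
    fix u v assume uv: "u \<in> carrier U" "v \<in> carrier U"
      and "(u <#\<^bsub>U\<^esub> carrier U) \<inter> (v <#\<^bsub>U\<^esub> carrier U) = {}"
    then have "((u, \<one>\<^bsub>A\<^esub>) <#\<^bsub>ZS\<^esub> carrier ZS) \<inter> ((v, \<one>\<^bsub>A\<^esub>) <#\<^bsub>ZS\<^esub> carrier ZS) = {}"
      by (simp add: U_ideal flip: Times_Int_distrib1)
    moreover have "(u, \<one>\<^bsub>A\<^esub>) \<in> carrier ZS" "(v, \<one>\<^bsub>A\<^esub>) \<in> carrier ZS" using uv by simp_all
    ultimately show "adj D (V (u, \<one>\<^bsub>A\<^esub>)) \<otimes> V (v, \<one>\<^bsub>A\<^esub>) = \<zero>"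
      using V unfolding covariant_rep_def by blast
  qed (simp add: V_iso)
  moreover have "isometric_rep A D (\<lambda>a. V (\<one>\<^bsub>U\<^esub>, a))"
    by (simp add: isometric_rep_def V_iso V_mult B3 B4)
  moreover have "V (\<one>\<^bsub>U\<^esub>, a) \<otimes> V (u, \<one>\<^bsub>A\<^esub>) = V (act a u, \<one>\<^bsub>A\<^esub>) \<otimes> V (\<one>\<^bsub>U\<^esub>, res a u)"
    if "a \<in> carrier A" "u \<in> carrier U" for a u
    using that by (simp add: V_mult act_closed res_closed B1 B7)
  moreover have "adj D (V (\<one>\<^bsub>U\<^esub>, a)) \<otimes> V (act a z, \<one>\<^bsub>A\<^esub>) = V (z, \<one>\<^bsub>A\<^esub>) \<otimes> adj D (V (\<one>\<^bsub>U\<^esub>, res a z))"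
    if "a \<in> carrier A" "z \<in> carrier U" for a z
  proof -
    let ?u = "act a z"
    have u: "?u \<in> carrier U" using act_closed that .
    have c: "res a z \<in> carrier A" using res_closed that .
    have prod: "(?u, \<one>\<^bsub>A\<^esub>) \<otimes>\<^bsub>ZS\<^esub> (\<one>\<^bsub>U\<^esub>, res a z) = (?u, res a z)"
      "(\<one>\<^bsub>U\<^esub>, a) \<otimes>\<^bsub>ZS\<^esub> (z, \<one>\<^bsub>A\<^esub>) = (?u, res a z)"
      using u c by (simp_all add: B1 B7)
    have "(?u <#\<^bsub>U\<^esub> carrier U) \<inter> (\<one>\<^bsub>U\<^esub> <#\<^bsub>U\<^esub> carrier U) = ?u <#\<^bsub>U\<^esub> carrier U"
      using U.principal_subset_carrier[OF u] by (auto simp: U.principal_one)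
    then have "((?u, \<one>\<^bsub>A\<^esub>) <#\<^bsub>ZS\<^esub> carrier ZS) \<inter> ((\<one>\<^bsub>U\<^esub>, a) <#\<^bsub>ZS\<^esub> carrier ZS) =
        ((?u, \<one>\<^bsub>A\<^esub>) \<otimes>\<^bsub>ZS\<^esub> (\<one>\<^bsub>U\<^esub>, res a z)) <#\<^bsub>ZS\<^esub> carrier ZS"
      by (intro ZS_common_multiple(2)[where y = z and w = ?u])
        (use u c that in \<open>simp_all add: B1 B7\<close>)
    then show ?thesis
      using u c that unfolding prod
      by (intro cov[OF _ prod(2,1)]) (auto simp: Int_commute)
  qed
  ultimately show ?thesis by (auto simp: zs_relations_def)
qed

end

section \<open>Comparing universal C*-algebras\<close>

lemma cstar_hom_id: "id \<in> cstar_hom C C"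
  by (auto simp: cstar_hom_def ring_hom_def)

lemma cstar_hom_closed: "\<phi> \<in> cstar_hom C D \<Longrightarrow> x \<in> carrier C \<Longrightarrow> \<phi> x \<in> carrier D"
  by (auto simp: cstar_hom_def ring_hom_def)

lemma cstar_hom_mult:
  "\<phi> \<in> cstar_hom C D \<Longrightarrow> x \<in> carrier C \<Longrightarrow> y \<in> carrier C \<Longrightarrow> \<phi> (x \<otimes>\<^bsub>C\<^esub> y) = \<phi> x \<otimes>\<^bsub>D\<^esub> \<phi> y"
  by (auto simp: cstar_hom_def ring_hom_def)

lemma cstar_hom_adj: "\<phi> \<in> cstar_hom C D \<Longrightarrow> x \<in> carrier C \<Longrightarrow> \<phi> (adj C x) = adj D (\<phi> x)"
  by (auto simp: cstar_hom_def)

lemma cstar_hom_comp: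
  "\<phi> \<in> cstar_hom C D \<Longrightarrow> \<psi> \<in> cstar_hom D E \<Longrightarrow> \<psi> \<circ> \<phi> \<in> cstar_hom C E"
  by (auto simp: cstar_hom_def ring_hom_def Pi_iff)

lemma universal_cstarD:
  assumes "universal_cstar I rel C g" "cstar_algebra D" "h ` I \<subseteq> carrier D" "rel D h"
  shows "\<exists>\<phi>\<in>cstar_hom C D. (\<forall>i\<in>I. \<phi> (g i) = h i) \<and>
      (\<forall>\<psi>\<in>cstar_hom C D. (\<forall>i\<in>I. \<psi> (g i) = h i) \<longrightarrow> (\<forall>x\<in>carrier C. \<psi> x = \<phi> x))"
  using assms(1)[unfolded universal_cstar_def, THEN conjunct2, THEN conjunct2, THEN conjunct2,
      THEN conjunct2, THEN spec[of _ D], THEN spec[of _ h]] assms(2-4)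
  by simp

lemma universal_cstar_hom:
  assumes "universal_cstar I rel C g" "cstar_algebra D" "h ` I \<subseteq> carrier D" "rel D h"
  shows "\<exists>\<phi>\<in>cstar_hom C D. \<forall>i\<in>I. \<phi> (g i) = h i"
  using universal_cstarD[OF assms] by (elim bexE conjE) (rule bexI)

text \<open>
  The uniqueness part of the universal property, for the algebra's own generators: the identity
  is the only endomorphism that fixes them.
\<close>

lemma universal_cstar_endo_id:
  assumes "universal_cstar I rel C g" "\<phi> \<in> cstar_hom C C" "\<And>i. i \<in> I \<Longrightarrow> \<phi> (g i) = g i"
    and x: "x \<in> carrier C"
  shows "\<phi> x = x"
proof -
  have "cstar_algebra C" "g ` I \<subseteq> carrier C" "rel C g"
    using assms(1) by (simp_all add: universal_cstar_def)
  from universal_cstarD[OF assms(1) this] obtain \<eta> where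
    \<eta>: "\<forall>\<psi>\<in>cstar_hom C C. (\<forall>i\<in>I. \<psi> (g i) = g i) \<longrightarrow> (\<forall>x\<in>carrier C. \<psi> x = \<eta> x)"
    by (elim bexE conjE)
  have "\<phi> x = \<eta> x"
    using bspec[OF \<eta> assms(2)] assms(3) x by simp
  moreover have "x = \<eta> x"
    using bspec[OF \<eta> cstar_hom_id] x by simp
  ultimately show ?thesis by simp
qed

lemma universal_cstar_iso:
  assumes C: "universal_cstar I rel C g" and D: "universal_cstar J rel' D h"
    and \<phi>: "\<phi> \<in> cstar_hom C D" and \<psi>: "\<psi> \<in> cstar_hom D C"
    and "\<And>i. i \<in> I \<Longrightarrow> \<psi> (\<phi> (g i)) = g i" and "\<And>j. j \<in> J \<Longrightarrow> \<phi> (\<psi> (h j)) = h j"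
  shows "\<phi> \<in> cstar_iso C D"
proof -
  have "\<psi> (\<phi> x) = x" if "x \<in> carrier C" for x
    using universal_cstar_endo_id[OF C cstar_hom_comp[OF \<phi> \<psi>]] assms(5) that by simp
  moreover have "\<phi> (\<psi> y) = y" if "y \<in> carrier D" for y
    using universal_cstar_endo_id[OF D cstar_hom_comp[OF \<psi> \<phi>]] assms(6) that by simp
  ultimately have "bij_betw \<phi> (carrier C) (carrier D)"
    using cstar_hom_closed[OF \<phi>] cstar_hom_closed[OF \<psi>]
    by (intro bij_betw_byWitness[where f' = \<psi>]) auto
  then show ?thesis using \<phi> by (simp add: cstar_iso_def)
qed

theorem theorem4p3:
  fixes U :: "('u, 'm) monoid_scheme" and A :: "('a, 'n) monoid_scheme"
    and act :: "'a \<Rightarrow> 'u \<Rightarrow> 'u" and res :: "'a \<Rightarrow> 'u \<Rightarrow> 'a"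
    and C AA :: "'c cstar_algebra"
    and v :: "'u \<times> 'a \<Rightarrow> 'c" and e :: "('u \<times> 'a) set \<Rightarrow> 'c"
    and s :: "'a \<Rightarrow> 'c" and t :: "'u \<Rightarrow> 'c"
  assumes "zappa_szep_maps U A act res"
    and "right_LCM_semigroup U"
    and "left_cancellative A"
    and "\<forall>X\<in>constructible_ideals A. \<forall>Y\<in>constructible_ideals A. X \<subseteq> Y \<or> Y \<subseteq> X"
    and "\<forall>a\<in>carrier A. bij_betw (act a) (carrier U) (carrier U)"
    and "full_semigroup_cstar (zappa_szep U A act res) C v e"
    and "zs_universal_cstar U A act res AA s t"
  shows "\<exists>\<pi>\<in>cstar_iso C AA. \<forall>u\<in>carrier U. \<forall>a\<in>carrier A.
    \<pi> (v (u, a)) = t u \<otimes>\<^bsub>AA\<^esub> s a \<and>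
    \<pi> (e ((u, a) <#\<^bsub>zappa_szep U A act res\<^esub> carrier (zappa_szep U A act res))) =
      t u \<otimes>\<^bsub>AA\<^esub> s a \<otimes>\<^bsub>AA\<^esub> adj AA (s a) \<otimes>\<^bsub>AA\<^esub> adj AA (t u)"
proof -
  interpret right_LCM_zappa_szep U A act res
    using assms(1-5) by (simp add: right_LCM_zappa_szep_def right_LCM_zappa_szep_axioms_def)
  note univC = assms(6)[unfolded full_semigroup_cstar_def]
  note univA = assms(7)[unfolded zs_universal_cstar_def]
  interpret C: cstar_algebra C using univC by (simp add: universal_cstar_def)
  interpret AA: cstar_algebra AA using univA by (simp add: universal_cstar_def)
  have li: "li_relations ZS C v e" and zs: "zs_relations U A act res AA s t"
    using univC univA by (simp_all add: universal_cstar_def comp_def)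
  have v: "isometric_rep ZS C v" using C.li_relations_isometric_rep[OF li] .
  have s: "isometric_rep A AA s" and t: "isometric_rep U AA t"
    using zs by (simp_all add: zs_relations_def covariant_rep_def)

  define V where "V = (\<lambda>(u, a). t u \<otimes>\<^bsub>AA\<^esub> s a)"
  have V: "covariant_rep ZS AA V"
    unfolding V_def by (rule zs_relations_covariant_rep[OF AA.cstar_algebra_axioms zs])
  obtain f where f: "li_relations ZS AA V f"
    using AA.covariant_rep_li_relations[OF right_LCM_ZS V] .
  have "case_sum V f ` (carrier ZS <+> constructible_ideals ZS) \<subseteq> carrier AA"
    using f by (auto simp: li_relations_def isometry_in_def projection_in_def)
  from universal_cstar_hom[OF univC AA.cstar_algebra_axioms this] f obtain \<phi>
    where \<phi>: "\<phi> \<in> cstar_hom C AA"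
    and \<phi>_gen: "\<forall>i\<in>carrier ZS <+> constructible_ideals ZS. \<phi> (case_sum v e i) = case_sum V f i"
    by (auto simp: case_sum_o_inj)
  have \<phi>_v: "\<phi> (v p) = V p" if "p \<in> carrier ZS" for p
    using bspec[OF \<phi>_gen InlI[OF that]] by simp
  have \<phi>_e: "\<phi> (e X) = f X" if "X \<in> constructible_ideals ZS" for X
    using bspec[OF \<phi>_gen InrI[OF that]] by simp

  define s' where "s' = (\<lambda>a. v (\<one>\<^bsub>U\<^esub>, a))"
  define t' where "t' = (\<lambda>u. v (u, \<one>\<^bsub>A\<^esub>))"
  have zs': "zs_relations U A act res C s' t'"
    unfolding s'_def t'_def
    by (rule covariant_rep_zs_relations[OF C.cstar_algebra_axioms C.li_relations_covariant_rep[OF monoid_ZS li]])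
  have "case_sum s' t' ` (carrier A <+> carrier U) \<subseteq> carrier C"
    using zs' by (auto simp: zs_relations_def covariant_rep_def isometric_rep_def isometry_in_def)
  from universal_cstar_hom[OF univA C.cstar_algebra_axioms this] zs' obtain \<psi>
    where \<psi>: "\<psi> \<in> cstar_hom AA C"
    and \<psi>_gen: "\<forall>i\<in>carrier A <+> carrier U. \<psi> (case_sum s t i) = case_sum s' t' i"
    by (auto simp: case_sum_o_inj)
  have \<psi>_s: "\<psi> (s a) = s' a" if "a \<in> carrier A" for a
    using bspec[OF \<psi>_gen InlI[OF that]] by simp
  have \<psi>_t: "\<psi> (t u) = t' u" if "u \<in> carrier U" for u
    using bspec[OF \<psi>_gen InrI[OF that]] by simp

  \<comment> \<open>This is \<open>(u, a) = (u, 1)(1, a)\<close>; the projections follow because they are range projections or 0.\<close>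
  have \<psi>_V: "\<psi> (V p) = v p" if carr: "p \<in> carrier ZS" for p
  proof -
    obtain u a where p: "p = (u, a)" "u \<in> carrier U" "a \<in> carrier A"
      using carr by (metis ZS_carrier surj_pair)
    have "\<psi> (V p) = t' u \<otimes>\<^bsub>C\<^esub> s' a"
      using p AA.isometric_repD(1)[OF s] AA.isometric_repD(1)[OF t]
      by (simp add: V_def cstar_hom_mult[OF \<psi>] \<psi>_s \<psi>_t)
    also have "\<dots> = v p"
      using p by (simp add: s'_def t'_def C.isometric_rep_mult[OF v] B3 B7 B1)
    finally show ?thesis .
  qed
  have \<psi>_f: "\<psi> (f X) = e X" if X: "X \<in> constructible_ideals ZS" for X
    using right_LCM_constructible_principal[OF right_LCM_ZS X]
  proof (elim disjE bexE)
    assume "X = {}"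
    then have "e X = \<zero>\<^bsub>C\<^esub>" "f X = \<zero>\<^bsub>AA\<^esub>" using li f by (simp_all add: li_relations_def)
    moreover have "\<psi> \<zero>\<^bsub>AA\<^esub> = \<zero>\<^bsub>C\<^esub>"
      using \<psi> C.ring_axioms AA.ring_axioms by (intro ring_hom_zero) (auto simp: cstar_hom_def)
    ultimately show ?thesis by simp
  next
    fix p assume p: "p \<in> carrier ZS" "X = p <#\<^bsub>ZS\<^esub> carrier ZS"
    have "V p \<in> carrier AA" "adj AA (V p) \<in> carrier AA"
      using V p by (auto simp: covariant_rep_def dest: AA.isometric_repD)
    then show ?thesis
      using p by (simp add: AA.li_relations_principal[OF f] C.li_relations_principal[OF li]
        AA.range_projection_def C.range_projection_def cstar_hom_mult[OF \<psi>] cstar_hom_adj[OF \<psi>] \<psi>_V)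
  qed

  have "\<phi> \<in> cstar_iso C AA"
  proof (rule universal_cstar_iso[OF univC univA \<phi> \<psi>])
    fix i assume "i \<in> carrier ZS <+> constructible_ideals ZS"
    then show "\<psi> (\<phi> (case_sum v e i)) = case_sum v e i"
      by (auto simp: \<phi>_v \<phi>_e \<psi>_V \<psi>_f simp del: ZS_carrier)
  next
    \<comment> \<open>\<open>V\<^bsub>(1,a)\<^esub> = t\<^sub>1s\<^sub>a\<close> and \<open>V\<^bsub>(u,1)\<^esub> = t\<^sub>us\<^sub>1\<close>, where \<open>t\<^sub>1\<close> and \<open>s\<^sub>1\<close> are idempotent isometries, hence 1.\<close>
    fix j assume "j \<in> carrier A <+> carrier U"
    then show "\<phi> (\<psi> (case_sum s t j)) = case_sum s t j"
      using AA.isometric_repD(1)[OF s] AA.isometric_repD(1)[OF t]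
        AA.isometric_rep_one[OF A.monoid_axioms s] AA.isometric_rep_one[OF U.monoid_axioms t]
      by (auto simp: \<psi>_s \<psi>_t s'_def t'_def \<phi>_v V_def)
  qed
  moreover have "\<phi> (v (u, a)) = t u \<otimes>\<^bsub>AA\<^esub> s a \<and>
      \<phi> (e ((u, a) <#\<^bsub>ZS\<^esub> carrier ZS)) = t u \<otimes>\<^bsub>AA\<^esub> s a \<otimes>\<^bsub>AA\<^esub> adj AA (s a) \<otimes>\<^bsub>AA\<^esub> adj AA (t u)"
    if "u \<in> carrier U" "a \<in> carrier A" for u a
    using that AA.isometric_repD[OF s] AA.isometric_repD[OF t]
    by (simp add: \<phi>_v \<phi>_e ZS.principal_constructible AA.li_relations_principal[OF f]
        AA.range_projection_def V_def AA.adj_mult AA.m_assoc)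
  ultimately show ?thesis by blast
qed

end
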